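(* Let $n\ge 1$ and $r\ge 0$, and let $a_r\in Z(n)$ be the $r$th coefficient of the asymptotic expansion $\mathrm{Wg}_d(\mu)=\sum_{r\ge 0}\frac{a_r(\mu)}{d^{n+r}}$ (for all integers $d\ge n$ and all $\mu\vdash n$) of the unitary Weingarten function. The class basis resolution of $h_r(J_1,\dots,J_n)$ is of the form $$h_r(J_1,\dots,J_n)=(-1)^r\sum_{g\ge 0}\ \sum_{\substack{\mu\vdash n\\ \ell(\mu)=n-r+2g}}a_r(\mu)\,\mathcal{C}_\mu .$$ When $n>r\ge 1$, this is $$h_r(J_1,\dots,J_n)=(-1)^r\sum_{\substack{\mu\vdash n\\ \ell(\mu)=n-r}}\mathrm{Moeb}(\mu)\,\mathcal{C}_\mu+(-1)^r\sum_{g\ge 1}\ \sum_{\substack{\nu\vdash n\\ \ell(\nu)=n-r+2g}}a_r(\nu)\,\mathcal{C}_\nu .$$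
   Context: $S(n)$ is the symmetric group on $\{1,\dots,n\}$ and $Z(n)$ is the center of the group algebra $\mathbb{C}[S(n)]$. An element $\sum_\sigma f(\sigma)\sigma$ of $Z(n)$ is identified with the function $f:S(n)\to\mathbb{C}$, constant on conjugacy classes; $f(\mu)$ denotes its value on permutations of cycle type $\mu$. For a partition $\mu\vdash n$, $\ell(\mu)$ is its number of parts, and $\mathcal{C}_\mu\in Z(n)$ is the formal sum of all permutations in $S(n)$ of cycle type $\mu$; the $\mathcal{C}_\mu$ form the class basis of $Z(n)$. In the sums, $g$ ranges over integers. Jucys-Murphy elements: $J_1:=0$ and $J_i:=(1,i)+(2,i)+\dots+(i-1,i)\in\mathbb{C}[S(n)]$ for $2\le i\le n$. They commute pairwise. The complete homogeneous symmetric polynomials are $h_0:=1$ and $h_r(x_1,\dots,x_n):=\sum_{1\le i_1\le i_2\le\dots\le i_r\le n}x_{i_1}x_{i_2}\cdots x_{i_r}$ for $r\ge 1$. Symmetric polynomials in $J_1,\dots,J_n$ lie in $Z(n)$. Weingarten function: for an integer $d\ge n$, $\mathrm{Wg}_d\in Z(n)$ is the central function $$\mathrm{Wg}_d(\sigma)=\int_{\mathbb{U}_d}u_{11}\cdots u_{nn}\,\overline{u}_{1\sigma(1)}\cdots\overline{u}_{n\sigma(n)}\,dU,\qquad \sigma\in S(n),$$ where $\mathbb{U}_d$ is the group of $d\times d$ unitary matrices $U=(u_{ij})$ and $dU$ is normalized Haar measure. A theorem of Collins states that for $d\ge n$, $\mathrm{Wg}_d$ is invertible in $Z(n)$ with $\mathrm{Wg}_d^{-1}=\sum_{\mu\vdash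 n}d^{\ell(\mu)}\mathcal{C}_\mu$. Collins also showed that there exist central functions $a_0,a_1,\dots\in Z(n)$, independent of $d$, with $\mathrm{Wg}_d(\mu)=\sum_{r\ge 0}a_r(\mu)d^{-(n+r)}$ for all $\mu\vdash n$; this is called the asymptotic expansion of $\mathrm{Wg}_d$. Moebius function (of the non-crossing partition lattice $NC(n)$, viewed as a central function on $S(n)$): for $\mu=(\mu_1,\dots,\mu_\ell)\vdash n$ with $\ell=\ell(\mu)$ parts, $$\mathrm{Moeb}(\mu)=(-1)^{n-\ell}\prod_{i=1}^{\ell}\mathrm{Cat}_{\mu_i-1},\qquad \mathrm{Cat}_N=\frac{1}{N+1}\binom{2N}{N}.$$ *)

theory Defs
  imports
    "HOL-Probability.Probability"
    "HOL-Algebra.Sym_Groups"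
    "HOL-Combinatorics.Orbits"
    "Jordan_Normal_Form.Schur_Decomposition"
begin

section \<open>The group algebra of the symmetric group and its center\<close>

text \<open>For a finite group \<open>G\<close>, an element \<open>\<Sum>x. f(x) x\<close> of the complex group algebra is identified
  with its coefficient function \<open>f\<close>, which is normalised to be \<open>0\<close> outside the carrier.\<close>

definition group_algebra :: "('g, 'm) monoid_scheme \<Rightarrow> ('g \<Rightarrow> complex) ring" where
  "group_algebra G =
     \<lparr>carrier = {f. \<forall>x. x \<notin> carrier G \<longrightarrow> f x = 0},
      mult = (\<lambda>f g z. \<Sum>(x, y) | x \<in> carrier G \<and> y \<in> carrier G \<and> x \<otimes>\<^bsub>G\<^esub> y = z. f x * g y),
      one = (\<lambda>x. if x = \<one>\<^bsub>G\<^esub> then 1 else 0),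
      zero = (\<lambda>_. 0),
      add = (\<lambda>f g x. f x + g x)\<rparr>"

abbreviation CS :: "nat \<Rightarrow> ((nat \<Rightarrow> nat) \<Rightarrow> complex) ring" where
  "CS n \<equiv> group_algebra (sym_group n)"

definition center_CS :: "nat \<Rightarrow> ((nat \<Rightarrow> nat) \<Rightarrow> complex) set" where
  "center_CS n = {f \<in> carrier (CS n). \<forall>g \<in> carrier (CS n). f \<otimes>\<^bsub>CS n\<^esub> g = g \<otimes>\<^bsub>CS n\<^esub> f}"

section \<open>Partitions, cycle types and the class basis\<close>

text \<open>A partition is the multiset of its parts; its length is the size of that multiset.\<close>

definition partitions :: "nat \<Rightarrow> nat multiset set" where
  "partitions n = {\<mu>. sum_mset \<mu> = n \<and> 0 \<notin># \<mu>}"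

lemma finite_partitions: "finite (partitions n)"
proof (rule finite_subset)
  show "partitions n \<subseteq> (\<Union>k\<le>n. multisets_of_size {..n} k)"
  proof
    fix \<mu> assume "\<mu> \<in> partitions n"
    then have sum: "sum_mset \<mu> = n" and pos: "0 \<notin># \<mu>"
      by (auto simp: partitions_def)
    have "size \<mu> = (\<Sum>i \<in># \<mu>. 1)"
      by (simp add: size_multiset_overloaded_eq)
    also have "\<dots> \<le> (\<Sum>i \<in># \<mu>. i)"
      using pos by (intro sum_mset_mono) (metis One_nat_def Suc_leI gr0I)
    finally have "size \<mu> \<le> n" using sum by simp
    moreover have "i \<le> n" if "i \<in># \<mu>" for i
      using that sum by (metis le_add1 multi_member_split sum_mset.add_mset)
    ultimately show "\<mu> \<in> (\<Union>k\<le>n. multisets_of_size {..n} k)"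
      by (auto simp: multisets_of_size_def)
  qed
qed (auto intro: finite_multisets_of_size)

definition cycle_type :: "nat \<Rightarrow> (nat \<Rightarrow> nat) \<Rightarrow> nat multiset" where
  "cycle_type n \<sigma> = image_mset card (mset_set (Orbits.orbit \<sigma> ` {1..n}))"

definition class_sum :: "nat \<Rightarrow> nat multiset \<Rightarrow> (nat \<Rightarrow> nat) \<Rightarrow> complex" where
  "class_sum n \<mu> \<sigma> = (if \<sigma> permutes {1..n} \<and> cycle_type n \<sigma> = \<mu> then 1 else 0)"

text \<open>\<open>f(\<mu>)\<close> for a central function \<open>f\<close>: the choice of the permutation of cycle type \<open>\<mu>\<close> is immaterial
  because \<open>f\<close> is constant on conjugacy classes.\<close>

definition class_value :: "nat \<Rightarrow> ((nat \<Rightarrow> nat) \<Rightarrow> complex) \<Rightarrow> nat multiset \<Rightarrow> complex" where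
  "class_value n f \<mu> = f (SOME \<sigma>. \<sigma> permutes {1..n} \<and> cycle_type n \<sigma> = \<mu>)"

section \<open>Jucys-Murphy elements and complete homogeneous symmetric polynomials\<close>

definition jucys_murphy :: "nat \<Rightarrow> (nat \<Rightarrow> nat) \<Rightarrow> complex" where
  "jucys_murphy i \<sigma> = (\<Sum>k = 1..<i. if \<sigma> = Transposition.transpose k i then 1 else 0)"

text \<open>\<open>h\<^sub>r(x\<^sub>1, \<dots>, x\<^sub>n)\<close> in a ring \<open>R\<close>. Each monomial is multiplied out in increasing order of the
  indices, so no commutativity of \<open>R\<close> is presupposed.\<close>

definition complete_homogeneous :: "('a, 'm) ring_scheme \<Rightarrow> nat \<Rightarrow> nat \<Rightarrow> (nat \<Rightarrow> 'a) \<Rightarrow> 'a" where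
  "complete_homogeneous R n r x =
     (\<Oplus>\<^bsub>R\<^esub>is \<in> {is. length is = r \<and> set is \<subseteq> {1..n} \<and> sorted is}.
        foldr (\<lambda>i y. x i \<otimes>\<^bsub>R\<^esub> y) is \<one>\<^bsub>R\<^esub>)"

section \<open>Haar measure on the unitary group and the Weingarten function\<close>

definition unitary_group :: "nat \<Rightarrow> complex mat set" where
  "unitary_group d =
     {U \<in> carrier_mat d d. U * mat_adjoint U = 1\<^sub>m d \<and> mat_adjoint U * U = 1\<^sub>m d}"

text \<open>The Borel sets of the unitary group, as a subspace of the product of \<open>d\<^sup>2\<close> copies of the complex
  plane (for a finite product of second countable spaces, the product of the Borel
  \<open>\<sigma>\<close>-algebras is the Borel \<open>\<sigma>\<close>-algebra).\<close>

definition unitary_borel :: "nat \<Rightarrow> complex mat measure" where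
  "unitary_borel d =
     vimage_algebra (unitary_group d) (\<lambda>U. \<lambda>p \<in> {..<d} \<times> {..<d}. U $$ p)
       (\<Pi>\<^sub>M p \<in> {..<d} \<times> {..<d}. borel)"

definition normalized_haar :: "nat \<Rightarrow> complex mat measure \<Rightarrow> bool" where
  "normalized_haar d M \<longleftrightarrow>
     prob_space M \<and> sets M = sets (unitary_borel d) \<and>
     (\<forall>V \<in> unitary_group d. distr M M (\<lambda>U. V * U) = M)"

text \<open>Matrix entries are indexed from \<open>0\<close>, whereas the symmetric group acts on \<open>{1..n}\<close>.\<close>

definition weingarten :: "nat \<Rightarrow> complex mat measure \<Rightarrow> (nat \<Rightarrow> nat) \<Rightarrow> complex" where
  "weingarten n M \<sigma> =
     (if \<sigma> permutes {1..n}
      then \<integral>U. (\<Prod>i = 1..n. U $$ (i - 1, i - 1)) * (\<Prod>i = 1..n. cnj (U $$ (i - 1, \<sigma> i - 1))) \<partial>M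
      else 0)"

section \<open>The Moebius function\<close>

definition Cat :: "nat \<Rightarrow> complex" where
  "Cat N = 1 / of_nat (N + 1) * of_nat ((2 * N) choose N)"

definition Moeb :: "nat multiset \<Rightarrow> complex" where
  "Moeb \<mu> = (-1) ^ (sum_mset \<mu> - size \<mu>) * (\<Prod>i \<in># \<mu>. Cat (i - 1))"

end

theory Submission
  imports Defs
begin

text \<open>Write \<open>W\<^sub>n\<close> for the Weingarten function of \<open>S(n)\<close> as an element of the group algebra. The heart of the
  matter is the orthogonality relation \<open>W\<^sub>n (d + J\<^sub>n) = W\<^bsub>n-1\<^esub>\<close>
  (\<open>weingarten_orthogonality\<close>), where \<open>W\<^bsub>n-1\<^esub>\<close> is extended by zero from \<open>S(n - 1)\<close> to
  \<open>S(n)\<close>. It follows from the orthonormality of the columns of a unitary matrix and from the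
  invariance of Haar measure under substitutions that mix two rows. Iterating it gives
  \<open>W\<^sub>n = (d + J\<^sub>1)\<^sup>-\<^sup>1 \<cdots> (d + J\<^sub>n)\<^sup>-\<^sup>1 = \<Sum>\<^sub>r (-1)\<^sup>r h\<^sub>r(J\<^sub>1, \<dots>, J\<^sub>n) / d\<^bsup>n+r\<^esup>\<close>
  for large \<open>d\<close> (\<open>weingarten_on_eq_jucys_series\<close>). Expansions in powers of \<open>1 / d\<close> are unique, so
  \<open>a\<^sub>r = (-1)\<^sup>r h\<^sub>r(J\<^sub>1, \<dots>, J\<^sub>n)\<close>.

  For this identification at every permutation one has to know that \<open>W\<^sub>n\<close> is constant on conjugacy
  classes. The orthogonality relation holds for each index in the role of \<open>n\<close> and determines \<open>W\<^sub>n\<close>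
  uniquely; therefore \<open>W\<^sub>n\<close> inherits the invariance of this system of relations under relabelling
  (\<open>weingarten_on_conj\<close>).

  It remains to describe \<open>h\<^sub>r(J\<^sub>1, \<dots>, J\<^sub>n)\<close>, whose coefficients count products of \<open>r\<close> transpositions
  with weakly increasing larger elements. Each transposition changes the number of cycles by one, so only
  cycle types with \<open>n - r + 2 g\<close> parts and \<open>g \<ge> 0\<close> occur (\<open>h_coeff_nonzero_imp_length\<close>). For
  \<open>g = 0\<close> each removal of a factor cuts a cycle, and the resulting recursion is that of a product of Catalan
  numbers (\<open>h_coeff_leading\<close>), which up to the sign \<open>(-1)\<^sup>r\<close> is the Moebius function.\<close>

section \<open>Cycles and multiplication by a transposition\<close>

lemma orbit_eq_image_of_cycle:
  assumes "0 < j" and step: "\<And>i. 0 < i \<Longrightarrow> i < j \<Longrightarrow> f (v i) = v (Suc i)" and wrap: "f (v j) = v 1"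
  shows "Orbits.orbit f (v j) = v ` {1..j}"
proof
  show "Orbits.orbit f (v j) \<subseteq> v ` {1..j}"
  proof
    fix y assume "y \<in> Orbits.orbit f (v j)"
    then show "y \<in> v ` {1..j}"
    proof induction
      case base
      then show ?case using wrap \<open>0 < j\<close> by auto
    next
      case (step y)
      then obtain i where i: "i \<in> {1..j}" "y = v i" by auto
      show ?case
      proof (cases "i = j")
        case True
        then show ?thesis using wrap i \<open>0 < j\<close> by auto
      next
        case False
        then have "f y = v (Suc i)" "Suc i \<in> {1..j}" using i assms(2)[of i] by auto
        then show ?thesis by blast
      qed
    qed
  qed
  have "Suc i \<le> j \<longrightarrow> v (Suc i) \<in> Orbits.orbit f (v j)" for i
  proof (induction i)
    case 0
    then show ?case using wrap Orbits.orbit.base[of f "v j"] by simp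
  next
    case (Suc i)
    then show ?case using step[of "Suc i"] Orbits.orbit.step[of "v (Suc i)" f "v j"] by auto
  qed
  then show "v ` {1..j} \<subseteq> Orbits.orbit f (v j)"
    by (metis (no_types, lifting) Suc_le_D atLeastAtMost_iff image_subsetI One_nat_def)
qed

lemma funpow_card_orbit:
  assumes "permutation f"
  shows "0 < card (Orbits.orbit f x)"
    and "(f ^^ card (Orbits.orbit f x)) x = x"
    and "inj_on (\<lambda>i. (f ^^ i) x) {0..<card (Orbits.orbit f x)}"
    and "Orbits.orbit f x = (\<lambda>i. (f ^^ i) x) ` {0..<card (Orbits.orbit f x)}"
proof -
  have self: "x \<in> Orbits.orbit f x" by (rule permutation_self_in_orbit[OF assms])
  define k where "k = funpow_dist1 f x x"
  have 1: "Orbits.orbit f x = (\<lambda>n. (f ^^ n) x) ` {0..<k}"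
    unfolding k_def by (rule orbit_conv_funpow_dist1[OF self])
  have 2: "inj_on (\<lambda>n. (f ^^ n) x) {0..<k}"
    unfolding k_def by (rule inj_on_funpow_dist1[OF self])
  have 3: "card (Orbits.orbit f x) = k" using 1 2 by (simp add: card_image)
  show "0 < card (Orbits.orbit f x)" using 3 by (simp add: k_def)
  show "(f ^^ card (Orbits.orbit f x)) x = x" using funpow_dist1_prop[OF self] 3 by (simp add: k_def)
  show "inj_on (\<lambda>i. (f ^^ i) x) {0..<card (Orbits.orbit f x)}" using 2 3 by simp
  show "Orbits.orbit f x = (\<lambda>i. (f ^^ i) x) ` {0..<card (Orbits.orbit f x)}" using 1 3 by simp
qed

lemma funpow_eq_iff_mod_card_orbit:
  assumes "permutation f"
  shows "(f ^^ m) x = (f ^^ l) x \<longleftrightarrow> m mod card (Orbits.orbit f x) = l mod card (Orbits.orbit f x)"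
proof -
  let ?k = "card (Orbits.orbit f x)"
  note k = funpow_card_orbit[OF assms, of x]
  have "(f ^^ m) x = (f ^^ (m mod ?k)) x" "(f ^^ l) x = (f ^^ (l mod ?k)) x"
    using funpow_mod_eq[OF k(2)] by simp_all
  moreover have "m mod ?k \<in> {0..<?k}" "l mod ?k \<in> {0..<?k}" using k(1) by auto
  ultimately show ?thesis using inj_on_eq_iff[OF k(3)] by metis
qed

text \<open>Multiplying by the transposition of two points \<open>a\<close> and \<open>b = \<sigma>\<^sup>j a\<close> of one cycle short-circuits the
  cycle: following \<open>\<sigma>\<close> from \<open>a\<close>, the step that would leave \<open>b\<close> is taken from \<open>a\<close> and vice versa, so
  the cycle falls into the stretch up to \<open>b\<close> and the stretch after it. The lengths of both pieces are
  recorded because the Catalan recursion below sums over them.\<close>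

lemma orbit_split_by_transposition:
  fixes \<sigma> :: "'a \<Rightarrow> 'a"
  assumes \<sigma>: "permutation \<sigma>" and j: "0 < j" "j < card (Orbits.orbit \<sigma> a)"
  defines "b \<equiv> (\<sigma> ^^ j) a" and "k \<equiv> card (Orbits.orbit \<sigma> a)"
  defines "\<tau> \<equiv> \<sigma> \<circ> Transposition.transpose a b"
  shows "Orbits.orbit \<tau> b = (\<lambda>i. (\<sigma> ^^ i) a) ` {1..j}"
    and "Orbits.orbit \<tau> a = (\<lambda>i. (\<sigma> ^^ i) a) ` {Suc j..k}"
    and "x \<notin> Orbits.orbit \<sigma> a \<Longrightarrow> Orbits.orbit \<tau> x = Orbits.orbit \<sigma> x"
    and "inj_on (\<lambda>i. (\<sigma> ^^ i) a) {1..k}"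
    and "Orbits.orbit \<sigma> a = (\<lambda>i. (\<sigma> ^^ i) a) ` {1..k}"
proof -
  note c = funpow_card_orbit[OF \<sigma>, of a, folded k_def]
  have ka: "(\<sigma> ^^ k) a = a" by (rule c(2))
  have inj: "(\<sigma> ^^ i) a = (\<sigma> ^^ l) a \<Longrightarrow> i \<in> {1..k} \<Longrightarrow> l \<in> {1..k} \<Longrightarrow> i = l" for i l
    using funpow_eq_iff_mod_card_orbit[OF \<sigma>, of i a l, folded k_def]
    by (cases "i = k"; cases "l = k") auto
  then show inj': "inj_on (\<lambda>i. (\<sigma> ^^ i) a) {1..k}" by (auto simp: inj_on_def)
  show orb: "Orbits.orbit \<sigma> a = (\<lambda>i. (\<sigma> ^^ i) a) ` {1..k}"
    using orbit_eq_image_of_cycle[of k \<sigma> "\<lambda>i. (\<sigma> ^^ i) a"] c(1) ka by simp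
  have other: "\<tau> y = \<sigma> y" if "y \<noteq> a" "y \<noteq> b" for y
    using that by (simp add: \<tau>_def)
  have step: "\<tau> ((\<sigma> ^^ i) a) = (\<sigma> ^^ Suc i) a" if "0 < i" "i < k" "i \<noteq> j" for i
  proof -
    have "(\<sigma> ^^ i) a \<noteq> b" using inj[of i j] that j by (auto simp: b_def k_def)
    moreover have "(\<sigma> ^^ i) a \<noteq> a" using inj[of i k] that ka by auto
    ultimately show ?thesis using other by simp
  qed
  have \<tau>a: "\<tau> a = (\<sigma> ^^ Suc j) a" by (simp add: \<tau>_def b_def)
  have \<tau>b: "\<tau> b = \<sigma> a" by (simp add: \<tau>_def)
  have jk: "j < k" using j by (simp add: k_def)
  show "Orbits.orbit \<tau> b = (\<lambda>i. (\<sigma> ^^ i) a) ` {1..j}"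
    using orbit_eq_image_of_cycle[of j \<tau> "\<lambda>i. (\<sigma> ^^ i) a"] step jk j \<tau>b
    by (simp add: b_def)
  have "Orbits.orbit \<tau> ((\<sigma> ^^ (j + (k - j))) a) = (\<lambda>i. (\<sigma> ^^ (j + i)) a) ` {1..k - j}"
    by (rule orbit_eq_image_of_cycle) (use step jk j \<tau>a ka in auto)
  also have "\<dots> = (\<lambda>i. (\<sigma> ^^ i) a) ` ((+) j ` {1..k - j})" by (simp only: image_image)
  also have "(+) j ` {1..k - j} = {Suc j..k}" using jk by (simp only: image_add_atLeastAtMost) auto
  finally show "Orbits.orbit \<tau> a = (\<lambda>i. (\<sigma> ^^ i) a) ` {Suc j..k}" using jk ka by simp
  show "Orbits.orbit \<tau> x = Orbits.orbit \<sigma> x" if x: "x \<notin> Orbits.orbit \<sigma> a"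
  proof (rule orbit_cong)
    show "x \<in> Orbits.orbit \<sigma> x" by (rule permutation_self_in_orbit[OF \<sigma>])
    fix y assume y: "y \<in> Orbits.orbit \<sigma> x"
    have "y \<notin> Orbits.orbit \<sigma> a"
      using x y \<sigma> by (meson orbit_swap orbit_trans permutation_self_in_orbit)
    moreover have "a \<in> Orbits.orbit \<sigma> a" "b \<in> Orbits.orbit \<sigma> a"
      using orb jk j c(1) ka by (auto simp: b_def permutation_self_in_orbit[OF \<sigma>])
    ultimately have "y \<noteq> a" "y \<noteq> b" by auto
    then show "\<tau> y = \<sigma> y" by (rule other)
  qed
qed

lemma permutes_atLeastAtMost_permutation: "\<sigma> permutes {1..n::nat} \<Longrightarrow> permutation \<sigma>"
  using permutation_permutes by blast

lemma cycle_type_split: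
  assumes \<sigma>: "\<sigma> permutes {1..n}" and a: "a \<in> {1..n}"
    and j: "0 < j" "j < card (Orbits.orbit \<sigma> a)"
  shows "add_mset (card (Orbits.orbit \<sigma> a))
           (cycle_type n (\<sigma> \<circ> Transposition.transpose a ((\<sigma> ^^ j) a)))
       = add_mset j (add_mset (card (Orbits.orbit \<sigma> a) - j) (cycle_type n \<sigma>))"
proof -
  have p: "permutation \<sigma>" using \<sigma> by (rule permutes_atLeastAtMost_permutation)
  define b k \<tau> where "b = (\<sigma> ^^ j) a" and "k = card (Orbits.orbit \<sigma> a)"
    and "\<tau> = \<sigma> \<circ> Transposition.transpose a b"
  note sp = orbit_split_by_transposition[OF p j, folded b_def k_def, folded \<tau>_def]
  have jk: "j < k" using j by (simp add: k_def)
  define P where "P = Orbits.orbit \<tau> ` ({1..n} - Orbits.orbit \<sigma> a)"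
  have P: "P = Orbits.orbit \<sigma> ` ({1..n} - Orbits.orbit \<sigma> a)"
    unfolding P_def by (rule image_cong) (use sp(3) in auto)
  have sub: "Orbits.orbit \<sigma> a \<subseteq> {1..n}" by (rule permutes_orbit_subset[OF \<sigma> a])
  have b: "b \<in> {1..n}" unfolding b_def
    by (rule subsetD[OF sub funpow_in_orbit[OF permutation_self_in_orbit[OF p]]])
  have \<tau>: "\<tau> permutes {1..n}"
    unfolding \<tau>_def by (intro permutes_compose permutes_swap_id \<sigma> a b)
  have p\<tau>: "permutation \<tau>" using \<tau> by (rule permutes_atLeastAtMost_permutation)
  have union: "Orbits.orbit \<sigma> a = Orbits.orbit \<tau> b \<union> Orbits.orbit \<tau> a"
  proof -
    have "{1..k} = {1..j} \<union> {Suc j..k}" using jk by auto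
    then show ?thesis unfolding sp(5) sp(1) sp(2) by (simp only: image_Un)
  qed
  have inj: "inj_on (\<lambda>i. (\<sigma> ^^ i) a) {1..k}" by (rule sp(4))
  have cb: "card (Orbits.orbit \<tau> b) = j" unfolding sp(1)
    by (subst card_image) (use inj jk in \<open>auto intro: inj_on_subset\<close>)
  have ca: "card (Orbits.orbit \<tau> a) = k - j" unfolding sp(2)
    by (subst card_image) (use inj jk in \<open>auto intro: inj_on_subset\<close>)
  have ab: "Orbits.orbit \<tau> a \<inter> Orbits.orbit \<tau> b = {}"
    unfolding sp(1,2)
    by (subst inj_on_image_Int[OF inj, symmetric]) (use jk in auto)
  have ne: "Orbits.orbit \<tau> a \<noteq> Orbits.orbit \<tau> b"
    using ab orbit_nonempty[of \<tau> a] by auto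
  have im\<tau>: "Orbits.orbit \<tau> ` Orbits.orbit \<sigma> a = {Orbits.orbit \<tau> a, Orbits.orbit \<tau> b}"
  proof -
    have "Orbits.orbit \<tau> y = Orbits.orbit \<tau> a" if "y \<in> Orbits.orbit \<tau> a" for y
      using that cyclic_on_orbit'[OF p\<tau>] by (rule orbit_cyclic_eq3[rotated])
    moreover have "Orbits.orbit \<tau> y = Orbits.orbit \<tau> b" if "y \<in> Orbits.orbit \<tau> b" for y
      using that cyclic_on_orbit'[OF p\<tau>] by (rule orbit_cyclic_eq3[rotated])
    moreover have "a \<in> Orbits.orbit \<tau> a" "b \<in> Orbits.orbit \<tau> b"
      by (rule permutation_self_in_orbit[OF p\<tau>])+
    ultimately show ?thesis unfolding union by blast
  qed
  have im\<sigma>: "Orbits.orbit \<sigma> ` Orbits.orbit \<sigma> a = {Orbits.orbit \<sigma> a}"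
  proof -
    have "Orbits.orbit \<sigma> y = Orbits.orbit \<sigma> a" if "y \<in> Orbits.orbit \<sigma> a" for y
      using that cyclic_on_orbit'[OF p] by (rule orbit_cyclic_eq3[rotated])
    then show ?thesis using orbit_nonempty[of \<sigma> a] by blast
  qed
  have split: "{1..n} = ({1..n} - Orbits.orbit \<sigma> a) \<union> Orbits.orbit \<sigma> a" using sub by auto
  have O\<tau>: "Orbits.orbit \<tau> ` {1..n} = insert (Orbits.orbit \<tau> a) (insert (Orbits.orbit \<tau> b) P)"
    by (subst split, subst image_Un) (simp add: P_def im\<tau>)
  have O\<sigma>: "Orbits.orbit \<sigma> ` {1..n} = insert (Orbits.orbit \<sigma> a) P"
    by (subst split, subst image_Un) (simp add: P im\<sigma>)
  have disj: "X \<inter> Orbits.orbit \<sigma> a = {}" if "X \<in> P" for X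
  proof -
    from that obtain x where x: "X = Orbits.orbit \<sigma> x" "x \<notin> Orbits.orbit \<sigma> a" by (auto simp: P)
    show ?thesis
      using x p by (auto) (meson orbit_swap orbit_trans permutation_self_in_orbit)
  qed
  have notin: "Orbits.orbit \<sigma> a \<notin> P" "Orbits.orbit \<tau> a \<notin> P" "Orbits.orbit \<tau> b \<notin> P"
    using disj[of "Orbits.orbit \<sigma> a"] disj[of "Orbits.orbit \<tau> a"] disj[of "Orbits.orbit \<tau> b"]
      orbit_nonempty[of \<sigma> a] orbit_nonempty[of \<tau> a] orbit_nonempty[of \<tau> b] union
    by blast+
  have "finite P" by (simp add: P_def)
  then show ?thesis
    unfolding cycle_type_def b_def[symmetric] \<tau>_def[symmetric] k_def[symmetric] O\<tau> O\<sigma>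
    using notin ne by (simp add: ca cb k_def)
qed

text \<open>If \<open>a\<close> and \<open>b\<close> lie on different cycles, the new permutation enters the cycle of \<open>b\<close> directly from
  \<open>a\<close> and then runs through all of it. Merging is thereby reduced to splitting: \<open>a\<close> and \<open>b\<close> lie on
  one cycle of the product, and multiplying by the same transposition again undoes the merge.\<close>

lemma orbit_merge_by_transposition:
  assumes "a \<notin> Orbits.orbit \<sigma> b"
  shows "y \<in> Orbits.orbit \<sigma> b \<Longrightarrow> y \<in> Orbits.orbit (\<sigma> \<circ> Transposition.transpose a b) a"
proof (induction rule: Orbits.orbit.induct)
  case base
  have "\<sigma> b = (\<sigma> \<circ> Transposition.transpose a b) a" by simp
  then show ?case by (rule orbit_eqI(1))
next
  case (step y)
  let ?\<tau> = "\<sigma> \<circ> Transposition.transpose a b"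
  show ?case
  proof (cases "y = b")
    case True
    then have "\<sigma> y = ?\<tau> a" by simp
    then show ?thesis by (rule orbit_eqI(1))
  next
    case False
    then have "?\<tau> y = \<sigma> y" using step assms by (metis comp_apply transpose_apply_other)
    then have "\<sigma> y = ?\<tau> y" by simp
    then show ?thesis using step.IH by (rule orbit_eqI(2))
  qed
qed

lemma size_cycle_type_split:
  assumes \<sigma>: "\<sigma> permutes {1..n}" and a: "a \<in> {1..n}" and "a \<noteq> b" and b: "b \<in> Orbits.orbit \<sigma> a"
  shows "size (cycle_type n (\<sigma> \<circ> Transposition.transpose a b)) = Suc (size (cycle_type n \<sigma>))"
proof -
  have p: "permutation \<sigma>" using \<sigma> by (rule permutes_atLeastAtMost_permutation)
  obtain j where j: "j < card (Orbits.orbit \<sigma> a)" "b = (\<sigma> ^^ j) a"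
    using subsetD[OF equalityD1[OF funpow_card_orbit(4)[OF p, of a]] b]
    by (metis (no_types, lifting) atLeastLessThan_iff imageE)
  have "0 < j" using j \<open>a \<noteq> b\<close> by (cases j) auto
  from cycle_type_split[OF \<sigma> a this j(1)] show ?thesis
    unfolding j(2) by (metis size_add_mset Suc_inject)
qed

lemma size_cycle_type_merge:
  assumes \<sigma>: "\<sigma> permutes {1..n}" and a: "a \<in> {1..n}" and b: "b \<in> {1..n}"
    and nb: "b \<notin> Orbits.orbit \<sigma> a"
  shows "Suc (size (cycle_type n (\<sigma> \<circ> Transposition.transpose a b))) = size (cycle_type n \<sigma>)"
proof -
  let ?\<tau> = "\<sigma> \<circ> Transposition.transpose a b"
  have p: "permutation \<sigma>" using \<sigma> by (rule permutes_atLeastAtMost_permutation)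
  have "a \<notin> Orbits.orbit \<sigma> b"
    using nb p by (meson orbit_swap permutation_self_in_orbit)
  from orbit_merge_by_transposition[OF this, of b]
  have ba: "b \<in> Orbits.orbit ?\<tau> a" by (simp add: permutation_self_in_orbit[OF p])
  have \<tau>: "?\<tau> permutes {1..n}" by (intro permutes_compose permutes_swap_id \<sigma> a b)
  have "a \<noteq> b" using nb permutation_self_in_orbit[OF p] by auto
  from size_cycle_type_split[OF \<tau> a this ba]
  show ?thesis by (simp add: comp_assoc)
qed

lemma bij_betw_of_image_mset_eq:
  assumes fin: "finite A" "finite B"
    and eq: "image_mset f (mset_set A) = image_mset g (mset_set B)"
  obtains F where "bij_betw F A B" "\<And>x. x \<in> A \<Longrightarrow> g (F x) = f x"
proof -
  have "card {x \<in> A. f x = v} = card {x \<in> B. g x = v}" for v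
  proof -
    have "card {x \<in> A. f x = v} = count (image_mset f (mset_set A)) v"
      using fin by (simp add: count_image_mset' Int_def) (rule arg_cong[of _ _ card], auto)
    also have "\<dots> = count (image_mset g (mset_set B)) v" by (simp add: eq)
    also have "\<dots> = card {x \<in> B. g x = v}"
      using fin by (simp add: count_image_mset' Int_def) (rule arg_cong[of _ _ card], auto)
    finally show ?thesis .
  qed
  then have "\<exists>h. bij_betw h {x \<in> A. f x = v} {x \<in> B. g x = v}" for v
    using fin by (intro finite_same_card_bij) auto
  then obtain h where h: "\<And>v. bij_betw (h v) {x \<in> A. f x = v} {x \<in> B. g x = v}" by metis
  have hin: "h (f x) x \<in> B \<and> g (h (f x) x) = f x" if "x \<in> A" for x
    using bij_betwE[OF h[of "f x"]] that by auto
  have "bij_betw (\<lambda>x. h (f x) x) A B"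
  proof (rule bij_betw_imageI)
    show "inj_on (\<lambda>x. h (f x) x) A"
    proof (rule inj_onI)
      fix x y assume xy: "x \<in> A" "y \<in> A" "h (f x) x = h (f y) y"
      then have "f x = f y" using hin by metis
      then show "x = y" using xy bij_betw_imp_inj_on[OF h[of "f x"]] by (auto simp: inj_on_def)
    qed
    show "(\<lambda>x. h (f x) x) ` A = B"
    proof
      show "(\<lambda>x. h (f x) x) ` A \<subseteq> B" using hin by auto
      show "B \<subseteq> (\<lambda>x. h (f x) x) ` A"
      proof
        fix y assume "y \<in> B"
        then have "y \<in> h (g y) ` {x \<in> A. f x = g y}"
          using bij_betw_imp_surj_on[OF h[of "g y"]] by auto
        then obtain x where x: "x \<in> A" "f x = g y" "y = h (g y) x" by auto
        then have "y = h (f x) x" by simp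
        then show "y \<in> (\<lambda>x. h (f x) x) ` A" using x(1) by (rule image_eqI)
      qed
    qed
  qed
  then show ?thesis using hin by (intro that) auto
qed

text \<open>Match the cycles of \<open>\<sigma>\<close> with cycles of \<open>\<tau>\<close> of the same length, choose a base point on each, and send
  \<open>\<sigma>\<^sup>m r\<close> to \<open>\<tau>\<^sup>m s\<close> for corresponding base points \<open>r\<close> and \<open>s\<close>. This is well defined because both
  sides depend only on \<open>m\<close> modulo the common cycle length.\<close>

lemma conjugate_of_same_cycle_type:
  assumes \<sigma>: "\<sigma> permutes {1..n}" and \<tau>: "\<tau> permutes {1..n}"
    and eq: "cycle_type n \<sigma> = cycle_type n \<tau>"
  obtains \<pi> where "\<pi> permutes {1..n}" "\<tau> = \<pi> \<circ> \<sigma> \<circ> inv_into UNIV \<pi>"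
proof -
  have p: "permutation \<sigma>" and q: "permutation \<tau>"
    using \<sigma> \<tau> by (auto intro: permutes_atLeastAtMost_permutation)
  obtain F where F: "bij_betw F (Orbits.orbit \<sigma> ` {1..n}) (Orbits.orbit \<tau> ` {1..n})"
    and cardF: "\<And>X. X \<in> Orbits.orbit \<sigma> ` {1..n} \<Longrightarrow> card (F X) = card X"
    using bij_betw_of_image_mset_eq[OF _ _ eq[unfolded cycle_type_def]] by auto
  define r s where "r x = (SOME y. y \<in> Orbits.orbit \<sigma> x)"
    and "s x = (SOME y. y \<in> F (Orbits.orbit \<sigma> x))" for x
  have r: "r x \<in> Orbits.orbit \<sigma> x" for x
    unfolding r_def using orbit_nonempty[of \<sigma> x] by (metis ex_in_conv someI_ex)
  have orb_r: "Orbits.orbit \<sigma> (r x) = Orbits.orbit \<sigma> x" for x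
    using r cyclic_on_orbit'[OF p] by (rule orbit_cyclic_eq3[rotated])
  have F_orbit: "\<exists>z \<in> {1..n}. F (Orbits.orbit \<sigma> x) = Orbits.orbit \<tau> z" if "x \<in> {1..n}" for x
    using bspec[OF bij_betwE[OF F] imageI[OF that]] by (metis (no_types, lifting) imageE)
  have s: "Orbits.orbit \<tau> (s x) = F (Orbits.orbit \<sigma> x)" if "x \<in> {1..n}" for x
  proof -
    from F_orbit[OF that] obtain z where z: "F (Orbits.orbit \<sigma> x) = Orbits.orbit \<tau> z" by auto
    have "s x \<in> Orbits.orbit \<tau> z"
      unfolding s_def z using orbit_nonempty[of \<tau> z] by (metis ex_in_conv someI_ex)
    then show ?thesis unfolding z using cyclic_on_orbit'[OF q] by (rule orbit_cyclic_eq3[rotated])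
  qed
  have period: "card (Orbits.orbit \<tau> (s x)) = card (Orbits.orbit \<sigma> (r x))" if "x \<in> {1..n}" for x
    using that by (simp add: s orb_r cardF)
  define \<pi> where "\<pi> x = (if x \<in> {1..n} then (\<tau> ^^ funpow_dist \<sigma> (r x) x) (s x) else x)" for x
  have \<pi>: "\<pi> y = (\<tau> ^^ m) (s x)"
    if x: "x \<in> {1..n}" and y: "y = (\<sigma> ^^ m) (r x)" for x y m
  proof -
    have yx: "y \<in> Orbits.orbit \<sigma> x" unfolding y using r by (rule funpow_in_orbit)
    then have orb: "Orbits.orbit \<sigma> y = Orbits.orbit \<sigma> x"
      using cyclic_on_orbit'[OF p] by (rule orbit_cyclic_eq3[rotated])
    then have same: "r y = r x" "s y = s x" by (simp_all add: r_def s_def)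
    have yn: "y \<in> {1..n}" using yx permutes_orbit_subset[OF \<sigma> x] by auto
    have "(\<sigma> ^^ funpow_dist \<sigma> (r x) y) (r x) = y"
      by (rule funpow_dist_prop) (use yx orb_r in simp)
    then have "(\<sigma> ^^ funpow_dist \<sigma> (r x) y) (r x) = (\<sigma> ^^ m) (r x)" using y by simp
    then have "(\<tau> ^^ funpow_dist \<sigma> (r x) y) (s x) = (\<tau> ^^ m) (s x)"
      by (simp add: funpow_eq_iff_mod_card_orbit[OF p] funpow_eq_iff_mod_card_orbit[OF q] period[OF x])
    then show ?thesis using yn same by (simp add: \<pi>_def)
  qed
  have reach: "\<exists>m. x = (\<sigma> ^^ m) (r x)" for x
    using permutation_self_in_orbit[OF p, of x] funpow_card_orbit(4)[OF p, of "r x"] orb_r[of x]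
    by auto
  have comm: "\<pi> (\<sigma> x) = \<tau> (\<pi> x)" for x
  proof (cases "x \<in> {1..n}")
    case True
    from reach obtain m where m: "x = (\<sigma> ^^ m) (r x)" by blast
    have "\<sigma> x = (\<sigma> ^^ Suc m) (r x)" by (subst m) simp
    from \<pi>[OF True this] \<pi>[OF True m] show ?thesis by simp
  next
    case False
    then have "\<sigma> x = x" "\<tau> x = x" "\<pi> x = x"
      using permutes_not_in[OF \<sigma>] permutes_not_in[OF \<tau>] by (auto simp: \<pi>_def)
    then show ?thesis by simp
  qed
  have surj: "{1..n} \<subseteq> \<pi> ` {1..n}"
  proof
    fix y assume y: "y \<in> {1..n}"
    then obtain x where x: "x \<in> {1..n}" "F (Orbits.orbit \<sigma> x) = Orbits.orbit \<tau> y"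
      using bij_betw_imp_surj_on[OF F] by (metis (no_types, lifting) imageE image_eqI)
    have "y \<in> Orbits.orbit \<tau> (s x)" using x s permutation_self_in_orbit[OF q] by simp
    then obtain m where m: "y = (\<tau> ^^ m) (s x)" using funpow_card_orbit(4)[OF q, of "s x"] by auto
    let ?z = "(\<sigma> ^^ m) (r x)"
    have "\<pi> ?z = y" using \<pi>[OF x(1)] m by simp
    moreover have "?z \<in> {1..n}"
      using funpow_in_orbit[OF r, of m x] permutes_orbit_subset[OF \<sigma> x(1)] by auto
    ultimately show "y \<in> \<pi> ` {1..n}" by (metis image_eqI)
  qed
  then have inj: "inj_on \<pi> {1..n}" and im: "\<pi> ` {1..n} = {1..n}"
  proof -
    have "card (\<pi> ` {1..n}) \<le> card {1..n}" by (rule card_image_le) simp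
    moreover have "finite (\<pi> ` {1..n})" by simp
    ultimately show im: "\<pi> ` {1..n} = {1..n}" using surj by (metis card_seteq)
    show "inj_on \<pi> {1..n}" by (rule eq_card_imp_inj_on) (simp_all only: im finite_atLeastAtMost)
  qed
  have perm: "\<pi> permutes {1..n}"
    by (rule bij_imp_permutes) (use inj im in \<open>auto simp: bij_betw_def \<pi>_def\<close>)
  have "\<pi> \<circ> \<sigma> \<circ> inv_into UNIV \<pi> = \<tau> \<circ> (\<pi> \<circ> inv_into UNIV \<pi>)" using comm by (auto simp: fun_eq_iff)
  also have "\<dots> = \<tau>" using perm by (simp add: permutes_inv_o)
  finally show ?thesis using that perm by metis
qed

lemma permutes_comp_transpose_iff:
  assumes "a \<in> S" "b \<in> S"
  shows "\<sigma> \<circ> Transposition.transpose a b permutes S \<longleftrightarrow> \<sigma> permutes S"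
proof
  have t: "Transposition.transpose a b permutes S" using assms by (rule permutes_swap_id)
  show "\<sigma> \<circ> Transposition.transpose a b permutes S" if "\<sigma> permutes S"
    using t that by (rule permutes_compose)
  assume "\<sigma> \<circ> Transposition.transpose a b permutes S"
  then have "\<sigma> \<circ> Transposition.transpose a b \<circ> Transposition.transpose a b permutes S"
    by (rule permutes_compose[OF t])
  then show "\<sigma> permutes S" by (simp only: comp_assoc transpose_comp_involutory comp_id)
qed

lemma transpose_comp_permutes_iff:
  assumes "a \<in> S" "b \<in> S"
  shows "Transposition.transpose a b \<circ> \<sigma> permutes S \<longleftrightarrow> \<sigma> permutes S"
proof
  have t: "Transposition.transpose a b permutes S" using assms by (rule permutes_swap_id)
  show "Transposition.transpose a b \<circ> \<sigma> permutes S" if "\<sigma> permutes S"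
    using that t by (rule permutes_compose)
  assume "Transposition.transpose a b \<circ> \<sigma> permutes S"
  then have "Transposition.transpose a b \<circ> (Transposition.transpose a b \<circ> \<sigma>) permutes S"
    using t by (rule permutes_compose)
  then show "\<sigma> permutes S"
    by (simp only: comp_assoc[symmetric] transpose_comp_involutory id_comp)
qed

lemma cycle_type_Suc:
  assumes \<sigma>: "\<sigma> permutes {1..n}"
  shows "cycle_type (Suc n) \<sigma> = add_mset 1 (cycle_type n \<sigma>)"
proof -
  have "\<sigma> (Suc n) = Suc n" using \<sigma> by (simp add: permutes_not_in)
  then have "Orbits.orbit \<sigma> (Suc n) = {Suc n}" by (simp add: orbit_eq_singleton_iff)
  moreover have "{1..Suc n} = insert (Suc n) {1..n}" by auto
  ultimately have "Orbits.orbit \<sigma> ` {1..Suc n} = insert {Suc n} (Orbits.orbit \<sigma> ` {1..n})"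
    by simp
  moreover have "{Suc n} \<notin> Orbits.orbit \<sigma> ` {1..n}"
    using permutes_orbit_subset[OF \<sigma>] by fastforce
  ultimately show ?thesis by (simp add: cycle_type_def)
qed

lemma cycle_type_id: "cycle_type n id = replicate_mset n 1"
proof (induction n)
  case 0
  then show ?case by (simp add: cycle_type_def)
next
  case (Suc n)
  have "id permutes {1..n}" by (rule permutes_id)
  from cycle_type_Suc[OF this] show ?case by (simp only: Suc replicate_mset_Suc)
qed

lemma eq_id_of_size_cycle_type:
  assumes \<sigma>: "\<sigma> permutes {1..n}" and "size (cycle_type n \<sigma>) = n"
  shows "\<sigma> = id"
proof
  fix x
  have p: "permutation \<sigma>" using \<sigma> by (rule permutes_atLeastAtMost_permutation)
  have "inj_on (Orbits.orbit \<sigma>) {1..n}"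
    by (rule eq_card_imp_inj_on) (use assms(2) in \<open>simp_all add: cycle_type_def\<close>)
  then have "\<sigma> x = x" if "x \<in> {1..n}"
    using permutation_orbit_step[OF p, of x] permutes_in_image[OF \<sigma>, of x] that
    by (meson inj_onD)
  moreover have "\<sigma> x = x" if "x \<notin> {1..n}" using \<sigma> that by (rule permutes_not_in)
  ultimately show "\<sigma> x = id x" unfolding id_apply by blast
qed

lemma cycle_type_in_partitions:
  assumes \<sigma>: "\<sigma> permutes {1..n}"
  shows "cycle_type n \<sigma> \<in> partitions n"
proof -
  have p: "permutation \<sigma>" using \<sigma> by (rule permutes_atLeastAtMost_permutation)
  let ?O = "Orbits.orbit \<sigma> ` {1..n}"
  have sub: "X \<subseteq> {1..n}" if "X \<in> ?O" for X
  proof -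
    from that obtain x where "X = Orbits.orbit \<sigma> x" "x \<in> {1..n}" by (rule imageE)
    then show ?thesis using permutes_orbit_subset[OF \<sigma>] by simp
  qed
  have Union: "\<Union> ?O = {1..n}"
    using sub permutation_self_in_orbit[OF p] by auto
  have "pairwise disjnt ?O"
  proof (rule pairwiseI)
    fix X Y assume XY: "X \<in> ?O" "Y \<in> ?O" "X \<noteq> Y"
    then obtain x y where xy: "X = Orbits.orbit \<sigma> x" "Y = Orbits.orbit \<sigma> y" by auto
    show "disjnt X Y"
    proof (rule ccontr)
      assume "\<not> disjnt X Y"
      then obtain z where z: "z \<in> X" "z \<in> Y" by (auto simp: disjnt_def)
      then have "Orbits.orbit \<sigma> z = X" "Orbits.orbit \<sigma> z = Y"
        unfolding xy using orbit_cyclic_eq3[OF cyclic_on_orbit'[OF p]] by blast+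
      then show False using XY(3) by simp
    qed
  qed
  then have "(\<Sum>X \<in> ?O. card X) = n"
    using card_Union_disjoint[of ?O] sub Union finite_subset[OF sub] by simp
  moreover have "0 \<notin> card ` ?O"
  proof
    assume "0 \<in> card ` ?O"
    then obtain x where "card (Orbits.orbit \<sigma> x) = 0" by auto
    then show False using funpow_card_orbit(1)[OF p, of x] by simp
  qed
  ultimately show ?thesis
    by (simp add: partitions_def cycle_type_def sum_unfold_sum_mset)
qed

section \<open>Catalan numbers\<close>

lemma Cat_Suc_times: "of_nat (k + 2) * Cat (Suc k) = 2 * of_nat (2 * k + 1) * Cat k"
proof -
  have "Suc k * ((2 * k + 2) choose Suc k) = (2 * k + 2) * ((2 * k + 1) choose k)"
    using Suc_times_binomial_eq[of "2 * k + 1" k] by simp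
  moreover have "Suc k * ((2 * k + 1) choose k) = (2 * k + 1) * ((2 * k) choose k)"
    using binomial_absorb_comp[of "2 * k + 1" k] by simp
  ultimately have "Suc k * (Suc k * ((2 * k + 2) choose Suc k))
      = (2 * k + 2) * ((2 * k + 1) * ((2 * k) choose k))"
    by (metis mult.left_commute)
  moreover have "(2 * k + 2) * ((2 * k + 1) * ((2 * k) choose k))
      = Suc k * (2 * (2 * k + 1) * ((2 * k) choose k))"
    by (simp add: algebra_simps)
  ultimately have "Suc k * (Suc k * ((2 * k + 2) choose Suc k))
      = Suc k * (2 * (2 * k + 1) * ((2 * k) choose k))" by (rule trans)
  then have "Suc k * ((2 * k + 2) choose Suc k) = 2 * (2 * k + 1) * ((2 * k) choose k)"
    by (simp only: mult_cancel1 nat.distinct simp_thms)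
  then have "of_nat (Suc k) * of_nat ((2 * k + 2) choose Suc k)
      = (2 * of_nat (2 * k + 1) * of_nat ((2 * k) choose k) :: complex)"
    by (metis of_nat_mult of_nat_numeral)
  moreover have "of_nat (k + 2) * Cat (Suc k) = of_nat ((2 * k + 2) choose Suc k)"
  proof -
    have "(of_nat (Suc k + 1) :: complex) \<noteq> 0" by (simp only: of_nat_eq_0_iff)
    then show ?thesis by (simp add: Cat_def del: of_nat_Suc of_nat_add)
  qed
  moreover have "of_nat (Suc k) * Cat k = of_nat ((2 * k) choose k)"
  proof -
    have "(of_nat (k + 1) :: complex) \<noteq> 0" by (simp only: of_nat_eq_0_iff)
    then show ?thesis by (simp add: Cat_def del: of_nat_Suc of_nat_add)
  qed
  ultimately have "of_nat (Suc k) * (of_nat (k + 2) * Cat (Suc k))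
      = of_nat (Suc k) * (2 * of_nat (2 * k + 1) * Cat k)"
    by (metis mult.left_commute)
  then show ?thesis by (simp only: mult_cancel_left of_nat_eq_0_iff) simp
qed

text \<open>The generating function of the Catalan numbers is \<open>(1 - sqrt (1 - 4 x)) / (2 x)\<close>; this is the
  corresponding statement about the coefficients of the binomial series with exponent \<open>1 / 2\<close>.\<close>

lemma gbinomial_half_eq_Cat: "(1 / 2 :: complex) gchoose Suc k = (-1) ^ k * 2 * Cat k / 4 ^ Suc k"
proof (induction k)
  case 0
  then show ?case by (simp add: Cat_def)
next
  case (Suc k)
  have rec: "of_nat (k + 2) * ((1 / 2 :: complex) gchoose Suc (Suc k))
      = (1 / 2 - of_nat (Suc k)) * ((1 / 2) gchoose Suc k)"
    using trans[OF gbinomial_absorption[of "Suc k" "1 / 2 :: complex"]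
      gbinomial_absorb_comp[of "1 / 2 :: complex" "Suc k", symmetric]]
    by (simp only: add_2_eq_Suc')
  have "of_nat (k + 2) * ((1 / 2 :: complex) gchoose Suc (Suc k))
      = (1 / 2 - of_nat (Suc k)) * ((-1) ^ k * 2 * Cat k / 4 ^ Suc k)"
    unfolding rec Suc.IH ..
  also have "\<dots> = (-1) ^ Suc k * 2 * (2 * of_nat (2 * k + 1) * Cat k) / 4 ^ Suc (Suc k)"
    by (simp add: field_simps)
  also have "\<dots> = of_nat (k + 2) * ((-1) ^ Suc k * 2 * Cat (Suc k) / 4 ^ Suc (Suc k))"
    unfolding Cat_Suc_times[symmetric] by simp
  finally show ?case by (simp only: mult_cancel_left of_nat_eq_0_iff) simp
qed

text \<open>Squaring the binomial series with exponent \<open>1 / 2\<close> gives the polynomial \<open>1 + x\<close>, so its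
  coefficients have vanishing convolution from degree two on (Vandermonde). Separating the two extreme
  terms of that convolution leaves Segner's recurrence.\<close>

lemma Cat_convolution: "(\<Sum>i\<le>N. Cat i * Cat (N - i)) = Cat (Suc N)"
proof -
  let ?g = "\<lambda>k. (1 / 2 :: complex) gchoose k"
  have "(\<Sum>k\<in>{0..Suc (Suc N)}. ?g k * ?g (Suc (Suc N) - k)) = (1 gchoose Suc (Suc N))"
    using gbinomial_Vandermonde[of "1 / 2 :: complex" "1 / 2" "Suc (Suc N)"] by simp
  also have "\<dots> = of_nat (1 choose Suc (Suc N))"
    by (metis binomial_gbinomial of_nat_1)
  also have "\<dots> = 0" by simp
  finally have zero: "(\<Sum>k\<in>{0..Suc (Suc N)}. ?g k * ?g (Suc (Suc N) - k)) = 0" .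
  have "(\<Sum>k\<in>{0..Suc (Suc N)}. ?g k * ?g (Suc (Suc N) - k))
      = ?g 0 * ?g (Suc (Suc N)) + (\<Sum>k\<le>Suc N. ?g (Suc k) * ?g (Suc N - k))"
    unfolding atLeast0AtMost by (subst sum.atMost_Suc_shift) simp
  also have "(\<Sum>k\<le>Suc N. ?g (Suc k) * ?g (Suc N - k))
      = (\<Sum>k\<le>N. ?g (Suc k) * ?g (Suc N - k)) + ?g (Suc (Suc N)) * ?g 0"
    by (subst sum.atMost_Suc) simp
  finally have "2 * ?g (Suc (Suc N)) + (\<Sum>k\<in>{..N}. ?g (Suc k) * ?g (Suc N - k)) = 0"
    unfolding zero by (simp only: gbinomial_0 mult_1_left mult_1_right) simp
  moreover have "(\<Sum>k\<in>{..N}. ?g (Suc k) * ?g (Suc N - k))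
      = (-1) ^ N * 4 / 4 ^ Suc (Suc N) * (\<Sum>k\<le>N. Cat k * Cat (N - k))"
    unfolding sum_distrib_left
  proof (rule sum.cong)
    fix k assume "k \<in> {..N}"
    then have k: "Suc N - k = Suc (N - k)" and N: "N = k + (N - k)" by auto
    have "?g (Suc k) * ?g (Suc N - k) = ((-1) ^ k * 2 * Cat k / 4 ^ Suc k)
        * ((-1) ^ (N - k) * 2 * Cat (N - k) / 4 ^ Suc (N - k))"
      unfolding k gbinomial_half_eq_Cat ..
    also have "\<dots> = (-1) ^ (k + (N - k)) * 4 / 4 ^ Suc (Suc (k + (N - k))) * (Cat k * Cat (N - k))"
      by (simp add: power_add)
    also have "\<dots> = (-1) ^ N * 4 / 4 ^ Suc (Suc N) * (Cat k * Cat (N - k))"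
      using N by metis
    finally show "?g (Suc k) * ?g (Suc N - k) = \<dots>" .
  qed simp
  ultimately have "(-1) ^ N * 4 / 4 ^ Suc (Suc N) * ((\<Sum>k\<le>N. Cat k * Cat (N - k)) - Cat (Suc N)) = 0"
    unfolding gbinomial_half_eq_Cat by (simp add: field_simps)
  then show ?thesis by simp
qed

lemma Cat_nonzero: "Cat k \<noteq> 0"
proof -
  have "(of_nat (k + 1) :: complex) \<noteq> 0" by (simp only: of_nat_eq_0_iff)
  then show ?thesis by (simp add: Cat_def del: of_nat_Suc of_nat_add)
qed

section \<open>Coefficients of complete homogeneous polynomials in Jucys-Murphy elements\<close>

text \<open>The coefficient of \<open>\<sigma>\<close> in \<open>h\<^sub>r(J\<^sub>1, \<dots>, J\<^sub>n)\<close>, presented through the recursion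
  \<open>h\<^sub>r(x\<^sub>1, \<dots>, x\<^bsub>n+1\<^esub>) = h\<^sub>r(x\<^sub>1, \<dots>, x\<^sub>n) + h\<^bsub>r-1\<^esub>(x\<^sub>1, \<dots>, x\<^bsub>n+1\<^esub>) x\<^bsub>n+1\<^esub>\<close>,
  which has the same shape as the orthogonality recursion of the Weingarten function. The agreement with
  the symmetric polynomial in the group algebra is shown below.\<close>

fun h_coeff :: "nat \<Rightarrow> nat \<Rightarrow> (nat \<Rightarrow> nat) \<Rightarrow> complex" where
  "h_coeff n 0 \<sigma> = (if \<sigma> = id then 1 else 0)"
| "h_coeff 0 (Suc r) \<sigma> = 0"
| "h_coeff (Suc n) (Suc r) \<sigma> =
     h_coeff n (Suc r) \<sigma> + (\<Sum>k = 1..n. h_coeff (Suc n) r (\<sigma> \<circ> Transposition.transpose (Suc n) k))"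

lemma h_coeff_permutes: "h_coeff n r \<sigma> \<noteq> 0 \<Longrightarrow> \<sigma> permutes {1..n}"
proof (induction n r \<sigma> rule: h_coeff.induct)
  case (1 n \<sigma>)
  then show ?case by (simp add: permutes_id[unfolded id_def] id_def split: if_splits)
next
  case (2 r \<sigma>)
  then show ?case by simp
next
  case (3 n r \<sigma>)
  show ?case
  proof (cases "h_coeff n (Suc r) \<sigma> = 0")
    case True
    then have "(\<Sum>k = 1..n. h_coeff (Suc n) r (\<sigma> \<circ> Transposition.transpose (Suc n) k)) \<noteq> 0"
      using "3.prems" by simp
    then obtain k where k: "k \<in> {1..n}" "h_coeff (Suc n) r (\<sigma> \<circ> Transposition.transpose (Suc n) k) \<noteq> 0"
      by (rule sum.not_neutral_contains_not_neutral)
    then have "\<sigma> \<circ> Transposition.transpose (Suc n) k permutes {1..Suc n}" using "3.IH"(2) by blast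
    then show ?thesis using k by (subst (asm) permutes_comp_transpose_iff) auto
  next
    case False
    then have "\<sigma> permutes {1..n}" by (rule "3.IH"(1))
    then show ?thesis by (rule permutes_subset) auto
  qed
qed

text \<open>A crude bound whose only purpose is geometric growth in \<open>r\<close>: the series
  \<open>\<Sum>\<^sub>r (-1)\<^sup>r h\<^sub>r / d\<^bsup>n+r\<^esup>\<close> then converges for large \<open>d\<close>.\<close>

lemma norm_h_coeff_le: "cmod (h_coeff n r \<sigma>) \<le> real n ^ (2 * r)"
proof (induction n r \<sigma> rule: h_coeff.induct)
  case (3 n r \<sigma>)
  have "cmod (h_coeff (Suc n) (Suc r) \<sigma>) \<le> cmod (h_coeff n (Suc r) \<sigma>)
      + (\<Sum>k = 1..n. cmod (h_coeff (Suc n) r (\<sigma> \<circ> Transposition.transpose (Suc n) k)))"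
    unfolding h_coeff.simps by (intro order_trans[OF norm_triangle_ineq] add_left_mono norm_sum)
  also have "\<dots> \<le> real n ^ (2 * Suc r) + (\<Sum>k = 1..n. real (Suc n) ^ (2 * r))"
    by (intro add_mono sum_mono "3.IH")
  also have "\<dots> = real n ^ 2 * real n ^ (2 * r) + real n * real (Suc n) ^ (2 * r)"
    by (simp add: power_add power2_eq_square)
  also have "\<dots> \<le> real n ^ 2 * real (Suc n) ^ (2 * r) + real n * real (Suc n) ^ (2 * r)"
    by (intro add_right_mono mult_left_mono power_mono) auto
  also have "\<dots> = (real n ^ 2 + real n) * real (Suc n) ^ (2 * r)" by (simp add: algebra_simps)
  also have "\<dots> \<le> real (Suc n) ^ 2 * real (Suc n) ^ (2 * r)"
    by (intro mult_right_mono) (auto simp: power2_eq_square algebra_simps)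
  also have "\<dots> = real (Suc n) ^ (2 * Suc r)" by (simp add: power_add[symmetric])
  finally show ?case .
qed auto

text \<open>Every factor of a monomial is a transposition and changes the number of cycles by exactly one, starting
  from the \<open>n\<close> cycles of the identity. After \<open>r\<close> steps at least \<open>n - r\<close> cycles are left, and the
  parity of their number is determined.\<close>

lemma h_coeff_nonzero_imp_length:
  "h_coeff n r \<sigma> \<noteq> 0 \<Longrightarrow> n \<le> r + size (cycle_type n \<sigma>) \<and> even (n + r + size (cycle_type n \<sigma>))"
proof (induction n r \<sigma> rule: h_coeff.induct)
  case (1 n \<sigma>)
  then have "\<sigma> = id" by (simp split: if_splits)
  then have "cycle_type n \<sigma> = replicate_mset n 1" by (simp only: cycle_type_id)
  then show ?case by simp
next
  case (2 r \<sigma>)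
  then show ?case by simp
next
  case (3 n r \<sigma>)
  have \<sigma>: "\<sigma> permutes {1..Suc n}" using "3.prems" by (rule h_coeff_permutes)
  show ?case
  proof (cases "h_coeff n (Suc r) \<sigma> = 0")
    case True
    then have "(\<Sum>k = 1..n. h_coeff (Suc n) r (\<sigma> \<circ> Transposition.transpose (Suc n) k)) \<noteq> 0"
      using "3.prems" by simp
    then obtain k where k: "k \<in> {1..n}" "h_coeff (Suc n) r (\<sigma> \<circ> Transposition.transpose (Suc n) k) \<noteq> 0"
      by (rule sum.not_neutral_contains_not_neutral)
    let ?\<tau> = "\<sigma> \<circ> Transposition.transpose (Suc n) k"
    have IH: "Suc n \<le> r + size (cycle_type (Suc n) ?\<tau>) \<and> even (Suc n + r + size (cycle_type (Suc n) ?\<tau>))"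
      using k by (rule "3.IH"(2))
    show ?thesis
    proof (cases "k \<in> Orbits.orbit \<sigma> (Suc n)")
      case True
      have "size (cycle_type (Suc n) ?\<tau>) = Suc (size (cycle_type (Suc n) \<sigma>))"
        using \<sigma> _ _ True by (rule size_cycle_type_split) (use k in auto)
      then show ?thesis using IH by simp
    next
      case False
      have "Suc (size (cycle_type (Suc n) ?\<tau>)) = size (cycle_type (Suc n) \<sigma>)"
        using \<sigma> _ _ False by (rule size_cycle_type_merge) (use k in auto)
      then have "size (cycle_type (Suc n) \<sigma>) = Suc (size (cycle_type (Suc n) ?\<tau>))" ..
      then show ?thesis using IH by simp
    qed
  next
    case False
    then show ?thesis using "3.IH"(1) h_coeff_permutes[OF False] by (auto simp: cycle_type_Suc)
  qed
qed

text \<open>On permutations that need all \<open>r\<close> transpositions, removing the last factor of a monomial must cut a cycle.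
  If \<open>n + 1\<close> is not a fixed point, its cycle of length \<open>c\<close> is cut into pieces of length \<open>j\<close> and
  \<open>c - j\<close>, each \<open>0 < j < c\<close> occurring once, while all other cycles stay as they are. Hence the
  coefficient is multiplicative over cycles, and the weights satisfy Segner's recurrence.\<close>

lemma h_coeff_leading:
  "\<sigma> permutes {1..n} \<Longrightarrow> r + size (cycle_type n \<sigma>) = n
    \<Longrightarrow> h_coeff n r \<sigma> = (\<Prod>i \<in># cycle_type n \<sigma>. Cat (i - 1))"
proof (induction n r \<sigma> rule: h_coeff.induct)
  case (1 n \<sigma>)
  then have id: "\<sigma> = id" by (intro eq_id_of_size_cycle_type) auto
  then have "cycle_type n \<sigma> = replicate_mset n 1" by (simp only: cycle_type_id)
  moreover have "h_coeff n 0 \<sigma> = 1" using id by (simp only: h_coeff.simps refl if_True)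
  ultimately show ?case by (simp add: Cat_def)
next
  case (2 r \<sigma>)
  then show ?case by simp
next
  case (3 n r \<sigma>)
  let ?P = "\<lambda>\<sigma>. (\<Prod>i \<in># cycle_type (Suc n) \<sigma>. Cat (i - 1))"
  let ?\<tau> = "\<lambda>k. \<sigma> \<circ> Transposition.transpose (Suc n) k"
  note \<sigma> = "3.prems"(1)
  have p: "permutation \<sigma>" using \<sigma> by (rule permutes_atLeastAtMost_permutation)
  \<comment> \<open>If removing the last factor joins two cycles, too few are left for a product of \<open>r\<close> factors.\<close>
  have outside: "h_coeff (Suc n) r (?\<tau> k) = 0" if "k \<in> {1..n}" "k \<notin> Orbits.orbit \<sigma> (Suc n)" for k
  proof (rule ccontr)
    assume "h_coeff (Suc n) r (?\<tau> k) \<noteq> 0"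
    from h_coeff_nonzero_imp_length[OF this] have "Suc n \<le> r + size (cycle_type (Suc n) (?\<tau> k))" ..
    moreover have "Suc (size (cycle_type (Suc n) (?\<tau> k))) = size (cycle_type (Suc n) \<sigma>)"
      using \<sigma> _ _ that(2) by (rule size_cycle_type_merge) (use that in auto)
    ultimately show False using "3.prems"(2) by simp
  qed
  show ?case
  proof (cases "\<sigma> (Suc n) = Suc n")
    case True
    then have orb: "Orbits.orbit \<sigma> (Suc n) = {Suc n}" by (simp add: orbit_eq_singleton_iff)
    have \<sigma>': "\<sigma> permutes {1..n}"
      by (rule permutes_superset[OF \<sigma>]) (use True in \<open>auto simp: le_Suc_eq\<close>)
    have "h_coeff (Suc n) (Suc r) \<sigma> = h_coeff n (Suc r) \<sigma>"
      using outside orb by (auto intro!: sum.neutral)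
    also have "\<dots> = (\<Prod>i \<in># cycle_type n \<sigma>. Cat (i - 1))"
      by (rule "3.IH"(1)[OF \<sigma>']) (use "3.prems"(2) in \<open>simp add: cycle_type_Suc[OF \<sigma>']\<close>)
    also have "\<dots> = ?P \<sigma>" by (simp add: cycle_type_Suc[OF \<sigma>'] Cat_def)
    finally show ?thesis .
  next
    case False
    define c where "c = card (Orbits.orbit \<sigma> (Suc n))"
    note cyc = funpow_card_orbit[OF p, of "Suc n", folded c_def]
    have "c \<noteq> 1"
    proof
      assume "c = 1"
      then show False using cyc(2) False by simp
    qed
    then have c: "2 \<le> c" using cyc(1) by linarith
    have "\<not> \<sigma> permutes {1..n}" using False by (auto simp: permutes_not_in)
    then have "h_coeff n (Suc r) \<sigma> = 0" using h_coeff_permutes by blast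
    then have "h_coeff (Suc n) (Suc r) \<sigma> = (\<Sum>k = 1..n. h_coeff (Suc n) r (?\<tau> k))" by simp
    also have "\<dots> = (\<Sum>k \<in> Orbits.orbit \<sigma> (Suc n) - {Suc n}. h_coeff (Suc n) r (?\<tau> k))"
    proof (rule sum.mono_neutral_right)
      have "Orbits.orbit \<sigma> (Suc n) \<subseteq> {1..Suc n}" by (rule permutes_orbit_subset[OF \<sigma>]) simp
      moreover have "{1..Suc n} - {Suc n} = {1..n}" by auto
      ultimately show "Orbits.orbit \<sigma> (Suc n) - {Suc n} \<subseteq> {1..n}" by blast
      show "\<forall>k \<in> {1..n} - (Orbits.orbit \<sigma> (Suc n) - {Suc n}). h_coeff (Suc n) r (?\<tau> k) = 0"
      proof
        fix k assume k: "k \<in> {1..n} - (Orbits.orbit \<sigma> (Suc n) - {Suc n})"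
        then have "k \<in> {1..n}" "k \<noteq> Suc n" by auto
        then show "h_coeff (Suc n) r (?\<tau> k) = 0" using k by (intro outside) blast+
      qed
    qed simp
    also have "Orbits.orbit \<sigma> (Suc n) - {Suc n} = (\<lambda>j. (\<sigma> ^^ j) (Suc n)) ` {1..<c}"
    proof -
      have "{0..<c} = insert 0 {1..<c}" using c by auto
      then have "Orbits.orbit \<sigma> (Suc n) = insert (Suc n) ((\<lambda>j. (\<sigma> ^^ j) (Suc n)) ` {1..<c})"
        by (subst cyc(4)) simp
      moreover have "Suc n \<notin> (\<lambda>j. (\<sigma> ^^ j) (Suc n)) ` {1..<c}"
      proof
        assume "Suc n \<in> (\<lambda>j. (\<sigma> ^^ j) (Suc n)) ` {1..<c}"
        then obtain j where "j \<in> {1..<c}" "(\<sigma> ^^ j) (Suc n) = (\<sigma> ^^ 0) (Suc n)" by auto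
        then show False using inj_onD[OF cyc(3), of j 0] by auto
      qed
      ultimately show ?thesis by blast
    qed
    also have "(\<Sum>k \<in> (\<lambda>j. (\<sigma> ^^ j) (Suc n)) ` {1..<c}. h_coeff (Suc n) r (?\<tau> k))
        = (\<Sum>j \<in> {1..<c}. h_coeff (Suc n) r (?\<tau> ((\<sigma> ^^ j) (Suc n))))"
      by (subst sum.reindex) (use cyc(3) in \<open>auto intro: inj_on_subset\<close>)
    finally have sum: "h_coeff (Suc n) (Suc r) \<sigma> = (\<Sum>j \<in> {1..<c}. h_coeff (Suc n) r (?\<tau> ((\<sigma> ^^ j) (Suc n))))" .
    \<comment> \<open>Multiplied by the weight of the uncut cycle, so that both sides are products over multisets of cycle lengths.\<close>
    have summand: "Cat (c - 1) * h_coeff (Suc n) r (?\<tau> ((\<sigma> ^^ j) (Suc n)))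
        = Cat (j - 1) * Cat (c - j - 1) * ?P \<sigma>" if j: "j \<in> {1..<c}" for j
    proof -
      let ?k = "(\<sigma> ^^ j) (Suc n)"
      have k: "?k \<in> Orbits.orbit \<sigma> (Suc n)"
        by (rule funpow_in_orbit[OF permutation_self_in_orbit[OF p]])
      then have kS: "?k \<in> {1..Suc n}" using permutes_orbit_subset[OF \<sigma>, of "Suc n"] by auto
      have "?k \<noteq> Suc n" using inj_onD[OF cyc(3), of j 0] j by auto
      then have kn: "?k \<in> {1..n}" using kS by auto
      have \<tau>: "?\<tau> ?k permutes {1..Suc n}" using \<sigma> kS by (simp add: permutes_comp_transpose_iff)
      have split: "add_mset c (cycle_type (Suc n) (?\<tau> ?k))
          = add_mset j (add_mset (c - j) (cycle_type (Suc n) \<sigma>))"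
        unfolding c_def by (rule cycle_type_split[OF \<sigma>]) (use j in \<open>auto simp: c_def\<close>)
      have "size (cycle_type (Suc n) (?\<tau> ?k)) = Suc (size (cycle_type (Suc n) \<sigma>))"
        using arg_cong[OF split, of size] by simp
      then have "r + size (cycle_type (Suc n) (?\<tau> ?k)) = Suc n"
        using "3.prems"(2) by linarith
      then have "h_coeff (Suc n) r (?\<tau> ?k) = ?P (?\<tau> ?k)"
        by (rule "3.IH"(2)[OF kn \<tau>])
      moreover have "Cat (c - 1) * ?P (?\<tau> ?k) = Cat (j - 1) * Cat (c - j - 1) * ?P \<sigma>"
        using arg_cong[OF split, of "\<lambda>M. \<Prod>i \<in># M. Cat (i - 1)"] by simp
      ultimately show ?thesis by simp
    qed
    have "Cat (c - 1) * h_coeff (Suc n) (Suc r) \<sigma> = (\<Sum>j \<in> {1..<c}. Cat (j - 1) * Cat (c - j - 1)) * ?P \<sigma>"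
      unfolding sum sum_distrib_left sum_distrib_right by (rule sum.cong) (use summand in auto)
    also have "(\<Sum>j \<in> {1..<c}. Cat (j - 1) * Cat (c - j - 1)) = (\<Sum>i\<le>c - 2. Cat i * Cat (c - 2 - i))"
      by (rule sum.reindex_bij_witness[of _ Suc "\<lambda>j. j - 1"]) (use c in auto)
    also have "\<dots> = Cat (c - 1)" using Cat_convolution[of "c - 2"] c by (simp add: Suc_diff_Suc numeral_2_eq_2)
    finally show ?thesis using Cat_nonzero[of "c - 1"] by simp
  qed
qed

section \<open>The recursion computes the symmetric polynomial in the group algebra\<close>

lemma abelian_monoid_group_algebra: "abelian_monoid (group_algebra G)"
  by (rule abelian_monoidI) (auto simp: group_algebra_def algebra_simps)

lemma finsum_group_algebra:
  assumes "finite A" and "\<And>i. i \<in> A \<Longrightarrow> f i \<in> carrier (group_algebra G)"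
  shows "finsum (group_algebra G) f A x = (\<Sum>i\<in>A. f i x)"
proof -
  interpret abelian_monoid "group_algebra G" by (rule abelian_monoid_group_algebra)
  show ?thesis using assms
  proof (induction A rule: finite_induct)
    case empty
    have "finsum (group_algebra G) f {} = \<zero>\<^bsub>group_algebra G\<^esub>" by (rule finsum_empty)
    then show ?case by (simp only: sum.empty) (simp add: group_algebra_def)
  next
    case (insert i A)
    then have "finsum (group_algebra G) f (insert i A)
        = f i \<oplus>\<^bsub>group_algebra G\<^esub> finsum (group_algebra G) f A"
      by (intro finsum_insert) auto
    then show ?case using insert by (simp add: group_algebra_def)
  qed
qed

lemma CS_carrier: "f \<in> carrier (CS n) \<longleftrightarrow> (\<forall>\<sigma>. \<not> \<sigma> permutes {1..n} \<longrightarrow> f \<sigma> = 0)"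
  by (simp add: group_algebra_def sym_group_carrier)

lemma jucys_murphy_mult:
  assumes i: "i \<in> {1..n}" and f: "f \<in> carrier (CS n)"
  shows "(jucys_murphy i \<otimes>\<^bsub>CS n\<^esub> f) = (\<lambda>\<sigma>. \<Sum>k = 1..<i. f (Transposition.transpose k i \<circ> \<sigma>))"
proof
  fix \<sigma> :: "nat \<Rightarrow> nat"
  let ?P = "{(x, y). x permutes {1..n} \<and> y permutes {1..n} \<and> x \<circ> y = \<sigma>}"
  let ?t = "\<lambda>k. Transposition.transpose k i"
  have t: "?t k permutes {1..n}" if "k \<in> {1..<i}" for k
    using that i by (intro permutes_swap_id) auto
  have P: "finite ?P"
    by (rule finite_subset[of _ "{x. x permutes {1..n}} \<times> {x. x permutes {1..n}}"])
      (auto simp: finite_permutations)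
  have "(jucys_murphy i \<otimes>\<^bsub>CS n\<^esub> f) \<sigma> = (\<Sum>(x, y) \<in> ?P. jucys_murphy i x * f y)"
    by (simp add: group_algebra_def sym_group_carrier sym_group_mult)
  also have "\<dots> = (\<Sum>p \<in> ?P. \<Sum>k = 1..<i. if fst p = ?t k then f (snd p) else 0)"
    by (intro sum.cong) (auto simp: jucys_murphy_def sum_distrib_right intro!: sum.cong)
  also have "\<dots> = (\<Sum>k = 1..<i. \<Sum>p \<in> ?P. if fst p = ?t k then f (snd p) else 0)"
    by (rule sum.swap)
  also have "\<dots> = (\<Sum>k = 1..<i. f (?t k \<circ> \<sigma>))"
  proof (rule sum.cong[OF refl])
    fix k assume k: "k \<in> {1..<i}"
    have "(\<Sum>p \<in> ?P. if fst p = ?t k then f (snd p) else 0)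
        = (\<Sum>p \<in> ?P. if p = (?t k, ?t k \<circ> \<sigma>) then f (?t k \<circ> \<sigma>) else 0)"
    proof (rule sum.cong[OF refl])
      fix p assume "p \<in> ?P"
      then obtain x y where p: "p = (x, y)" "x \<circ> y = \<sigma>" by auto
      show "(if fst p = ?t k then f (snd p) else 0)
          = (if p = (?t k, ?t k \<circ> \<sigma>) then f (?t k \<circ> \<sigma>) else 0)"
      proof (cases "x = ?t k")
        case True
        then have "?t k \<circ> \<sigma> = ?t k \<circ> ?t k \<circ> y" using p(2) by (simp only: comp_assoc)
        then have "?t k \<circ> \<sigma> = y" by (simp only: transpose_comp_involutory id_comp)
        then show ?thesis using True p by simp
      next
        case False
        then show ?thesis using p by simp
      qed
    qed
    also have "\<dots> = (if (?t k, ?t k \<circ> \<sigma>) \<in> ?P then f (?t k \<circ> \<sigma>) else 0)"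
      using P by (rule sum.delta)
    also have "\<dots> = f (?t k \<circ> \<sigma>)"
    proof -
      have "?t k \<circ> (?t k \<circ> \<sigma>) = \<sigma>"
        by (simp only: comp_assoc[symmetric] transpose_comp_involutory id_comp)
      then show ?thesis using t[OF k] f by (auto simp: CS_carrier)
    qed
    finally show "(\<Sum>p \<in> ?P. if fst p = ?t k then f (snd p) else 0) = f (?t k \<circ> \<sigma>)" .
  qed
  finally show "(jucys_murphy i \<otimes>\<^bsub>CS n\<^esub> f) \<sigma> = (\<Sum>k = 1..<i. f (?t k \<circ> \<sigma>))" .
qed

text \<open>The product \<open>J\<^bsub>i1\<^esub> \<cdots> J\<^bsub>ir\<^esub>\<close> as a function on permutations. Defining it on all functions
  \<open>nat \<Rightarrow> nat\<close> keeps the group algebra out of the combinatorial recursions.\<close>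

fun jm_monomial :: "nat list \<Rightarrow> (nat \<Rightarrow> nat) \<Rightarrow> complex" where
  "jm_monomial [] \<sigma> = (if \<sigma> = id then 1 else 0)"
| "jm_monomial (i # is) \<sigma> = (\<Sum>k = 1..<i. jm_monomial is (Transposition.transpose k i \<circ> \<sigma>))"

lemma foldr_jucys_murphy:
  assumes "set is \<subseteq> {1..n}"
  shows "foldr (\<lambda>i y. jucys_murphy i \<otimes>\<^bsub>CS n\<^esub> y) is \<one>\<^bsub>CS n\<^esub> = jm_monomial is \<and> jm_monomial is \<in> carrier (CS n)"
  using assms
proof (induction "is")
  case Nil
  have "id permutes {1..n}" by (rule permutes_id)
  then have "jm_monomial [] \<sigma> = 0" if "\<not> \<sigma> permutes {1..n}" for \<sigma>
    using that by (metis jm_monomial.simps(1))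
  moreover have "\<one>\<^bsub>CS n\<^esub> = jm_monomial []"
    by (rule ext) (simp add: group_algebra_def sym_group_one)
  ultimately show ?case unfolding CS_carrier by simp
next
  case (Cons i "is")
  then have i: "i \<in> {1..n}" and IH: "foldr (\<lambda>i y. jucys_murphy i \<otimes>\<^bsub>CS n\<^esub> y) is \<one>\<^bsub>CS n\<^esub> = jm_monomial is"
      "jm_monomial is \<in> carrier (CS n)" by auto
  have "jm_monomial (i # is) \<sigma> = 0" if "\<not> \<sigma> permutes {1..n}" for \<sigma>
    using that IH(2) i by (auto simp: CS_carrier transpose_comp_permutes_iff)
  then have "jm_monomial (i # is) \<in> carrier (CS n)" by (auto simp only: CS_carrier)
  moreover have "foldr (\<lambda>i y. jucys_murphy i \<otimes>\<^bsub>CS n\<^esub> y) (i # is) \<one>\<^bsub>CS n\<^esub> = jm_monomial (i # is)"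
    using jucys_murphy_mult[OF i IH(2)] by (simp add: IH(1) fun_eq_iff)
  ultimately show ?case by blast
qed

text \<open>The factors of a word are multiplied up from the left, whereas the recursion for \<open>h\<^sub>r\<close> removes the last
  factor; associativity makes the two compatible.\<close>

lemma jm_monomial_snoc:
  "jm_monomial (is @ [i]) \<sigma> = (\<Sum>k = 1..<i. jm_monomial is (\<sigma> \<circ> Transposition.transpose k i))"
proof (induction "is" arbitrary: \<sigma>)
  case Nil
  have "Transposition.transpose k i \<circ> \<sigma> = id \<longleftrightarrow> \<sigma> \<circ> Transposition.transpose k i = id" for k
  proof -
    have "Transposition.transpose k i \<circ> \<sigma> = id \<longleftrightarrow> \<sigma> = Transposition.transpose k i"
      by (metis comp_id fun.map_comp id_comp comp_assoc transpose_comp_involutory)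
    moreover have "\<sigma> \<circ> Transposition.transpose k i = id \<longleftrightarrow> \<sigma> = Transposition.transpose k i"
      by (metis comp_id id_comp comp_assoc transpose_comp_involutory)
    ultimately show ?thesis by blast
  qed
  then show ?case by (simp only: append_Nil jm_monomial.simps)
next
  case (Cons j "is")
  show ?case by (simp only: append_Cons jm_monomial.simps Cons.IH comp_assoc) (rule sum.swap)
qed

text \<open>Sort the weakly increasing words over \<open>{1..n+1}\<close> by their last letter: either \<open>n + 1\<close> does not occur,
  or the last letter is \<open>n + 1\<close> and can be removed.\<close>

lemma sum_jm_monomial_eq_h_coeff:
  "(\<Sum>is | length is = r \<and> set is \<subseteq> {1..n} \<and> sorted is. jm_monomial is \<sigma>) = h_coeff n r \<sigma>"
proof (induction n r \<sigma> rule: h_coeff.induct)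
  case (1 n \<sigma>)
  have "{is :: nat list. length is = 0 \<and> set is \<subseteq> {1..n} \<and> sorted is} = {[]}" by auto
  then show ?case by (simp only:) simp
next
  case (2 r \<sigma>)
  have "{is :: nat list. length is = Suc r \<and> set is \<subseteq> {1..0} \<and> sorted is} = {}"
    by (auto simp: length_Suc_conv)
  then show ?case by (simp only:) simp
next
  case (3 n r \<sigma>)
  define L where "L n r = {is :: nat list. length is = r \<and> set is \<subseteq> {1..n} \<and> sorted is}" for n r
  have finL: "finite (L n r)" for n r
    unfolding L_def by (rule finite_subset[OF _ finite_lists_length_eq[of "{1..n}" r]]) auto
  have split: "L (Suc n) (Suc r) = L n (Suc r) \<union> (\<lambda>is. is @ [Suc n]) ` L (Suc n) r" (is "?A = ?B \<union> ?C")
  proof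
    show "?A \<subseteq> ?B \<union> ?C"
    proof
      fix xs assume xs: "xs \<in> ?A"
      then have "xs \<noteq> []" by (auto simp: L_def)
      then obtain ys y where ys: "xs = ys @ [y]" by (metis rev_exhaust)
      then have y: "\<forall>z \<in> set ys. z \<le> y" "y \<le> Suc n" "ys \<in> L (Suc n) r"
        using xs by (auto simp: L_def sorted_append)
      show "xs \<in> ?B \<union> ?C"
      proof (cases "y = Suc n")
        case True
        then show ?thesis using y ys by auto
      next
        case False
        then have "set xs \<subseteq> {1..n}" using y ys xs by (fastforce simp: L_def)
        then show ?thesis using xs by (auto simp: L_def)
      qed
    qed
    show "?B \<union> ?C \<subseteq> ?A" by (fastforce simp: L_def sorted_append)
  qed
  have disj: "?B \<inter> ?C = {}" by (auto simp: L_def)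
  have "(\<Sum>is\<in>L (Suc n) (Suc r). jm_monomial is \<sigma>)
      = (\<Sum>is\<in>L n (Suc r). jm_monomial is \<sigma>) + (\<Sum>is\<in>L (Suc n) r. jm_monomial (is @ [Suc n]) \<sigma>)"
    unfolding split by (subst sum.union_disjoint) (use finL disj in \<open>auto simp: sum.reindex inj_on_def\<close>)
  also have "(\<Sum>is\<in>L (Suc n) r. jm_monomial (is @ [Suc n]) \<sigma>)
      = (\<Sum>k = 1..n. \<Sum>is\<in>L (Suc n) r. jm_monomial is (\<sigma> \<circ> Transposition.transpose (Suc n) k))"
    unfolding jm_monomial_snoc atLeastLessThanSuc_atLeastAtMost transpose_commute[of _ "Suc n"]
    by (rule sum.swap)
  also have "\<dots> = (\<Sum>k = 1..n. h_coeff (Suc n) r (\<sigma> \<circ> Transposition.transpose (Suc n) k))"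
    unfolding L_def by (rule sum.cong[OF refl "3.IH"(2)])
  also have "(\<Sum>is\<in>L n (Suc r). jm_monomial is \<sigma>) = h_coeff n (Suc r) \<sigma>"
    unfolding L_def by (rule "3.IH"(1))
  finally show ?case unfolding L_def h_coeff.simps .
qed

lemma complete_homogeneous_jucys_murphy: "complete_homogeneous (CS n) n r jucys_murphy = h_coeff n r"
proof
  fix \<sigma>
  let ?L = "{is :: nat list. length is = r \<and> set is \<subseteq> {1..n} \<and> sorted is}"
  have fin: "finite ?L" by (rule finite_subset[OF _ finite_lists_length_eq[of "{1..n}" r]]) auto
  have "complete_homogeneous (CS n) n r jucys_murphy \<sigma>
      = (\<Sum>is\<in>?L. foldr (\<lambda>i y. jucys_murphy i \<otimes>\<^bsub>CS n\<^esub> y) is \<one>\<^bsub>CS n\<^esub> \<sigma>)"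
    unfolding complete_homogeneous_def
    by (rule finsum_group_algebra[OF fin]) (use foldr_jucys_murphy in simp)
  also have "\<dots> = (\<Sum>is\<in>?L. jm_monomial is \<sigma>)"
    by (rule sum.cong[OF refl]) (use foldr_jucys_murphy in simp)
  finally show "complete_homogeneous (CS n) n r jucys_murphy \<sigma> = h_coeff n r \<sigma>"
    unfolding sum_jm_monomial_eq_h_coeff .
qed

section \<open>Integration over the unitary group and the orthogonality relation\<close>

lemma mat_adjoint_index:
  assumes "U \<in> carrier_mat d d" "i < d" "j < d"
  shows "mat_adjoint U $$ (i, j) = cnj (U $$ (j, i))"
  using assms unfolding mat_adjoint_def by (auto simp: mat_of_rows_index)

lemma mat_adjoint_carrier: "U \<in> carrier_mat d d \<Longrightarrow> mat_adjoint U \<in> carrier_mat d d"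
  unfolding mat_adjoint_def by auto

lemma mat_mult_index_sum:
  assumes "A \<in> carrier_mat d d" "B \<in> carrier_mat d d" "i < d" "j < d"
  shows "(A * B) $$ (i, j) = (\<Sum>k<d. A $$ (i, k) * B $$ (k, j))"
  using assms by (auto simp: scalar_prod_def lessThan_atLeast0 intro!: sum.cong)

lemma unitary_rows_orthonormal:
  assumes "U \<in> unitary_group d" "i < d" "j < d"
  shows "(\<Sum>k<d. U $$ (i, k) * cnj (U $$ (j, k))) = (if i = j then 1 else 0)"
proof -
  have U: "U \<in> carrier_mat d d" "U * mat_adjoint U = 1\<^sub>m d" using assms by (auto simp: unitary_group_def)
  have "(\<Sum>k<d. U $$ (i, k) * cnj (U $$ (j, k))) = (U * mat_adjoint U) $$ (i, j)"
    by (subst mat_mult_index_sum[OF U(1) mat_adjoint_carrier[OF U(1)] assms(2,3)])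
      (auto intro!: sum.cong simp: mat_adjoint_index[OF U(1)] assms)
  then show ?thesis using U(2) assms by simp
qed

lemma unitary_columns_orthonormal:
  assumes "U \<in> unitary_group d" "i < d" "j < d"
  shows "(\<Sum>k<d. U $$ (k, i) * cnj (U $$ (k, j))) = (if i = j then 1 else 0)"
proof -
  have U: "U \<in> carrier_mat d d" "mat_adjoint U * U = 1\<^sub>m d" using assms by (auto simp: unitary_group_def)
  have "(\<Sum>k<d. U $$ (k, i) * cnj (U $$ (k, j))) = (mat_adjoint U * U) $$ (j, i)"
    by (subst mat_mult_index_sum[OF mat_adjoint_carrier[OF U(1)] U(1) assms(3,2)])
      (auto intro!: sum.cong simp: mat_adjoint_index[OF U(1)] assms)
  then show ?thesis using U(2) assms by simp
qed

lemma unitary_entry_norm_le_1: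
  assumes "U \<in> unitary_group d" "i < d" "j < d"
  shows "cmod (U $$ (i, j)) \<le> 1"
proof -
  have "complex_of_real (\<Sum>k<d. (cmod (U $$ (i, k)))\<^sup>2) = (\<Sum>k<d. U $$ (i, k) * cnj (U $$ (i, k)))"
    by (simp add: complex_norm_square del: of_real_power)
  also have "\<dots> = 1" using unitary_rows_orthonormal[OF assms(1,2,2)] by simp
  finally have "(\<Sum>k<d. (cmod (U $$ (i, k)))\<^sup>2) = 1" using of_real_eq_1_iff by blast
  moreover have "(cmod (U $$ (i, j)))\<^sup>2 \<le> (\<Sum>k<d. (cmod (U $$ (i, k)))\<^sup>2)"
    using assms(3) by (intro member_le_sum) auto
  ultimately show ?thesis by (simp add: power_le_one_iff abs_square_le_1)
qed

lemma left_mult_in_unitary_group: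
  assumes "V \<in> unitary_group d" "U \<in> unitary_group d"
  shows "V * U \<in> unitary_group d"
proof -
  have c: "V \<in> carrier_mat d d" "U \<in> carrier_mat d d" using assms by (auto simp: unitary_group_def)
  have c': "V * U \<in> carrier_mat d d" using c by simp
  note a = mat_adjoint_carrier[OF c(1)] mat_adjoint_carrier[OF c(2)]
  have adj: "mat_adjoint (V * U) = mat_adjoint U * mat_adjoint V"
  proof (rule eq_matI)
    fix i j assume "i < dim_row (mat_adjoint U * mat_adjoint V)" "j < dim_col (mat_adjoint U * mat_adjoint V)"
    then have ij: "i < d" "j < d" using a by auto
    show "mat_adjoint (V * U) $$ (i, j) = (mat_adjoint U * mat_adjoint V) $$ (i, j)"
      unfolding mat_adjoint_index[OF c' ij] mat_mult_index_sum[OF c ij(2,1)]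
        mat_mult_index_sum[OF a(2,1) ij] cnj_sum
      by (rule sum.cong) (auto simp: mat_adjoint_index[OF c(1)] mat_adjoint_index[OF c(2)] ij)
  qed (use a mat_adjoint_carrier[OF c'] in auto)
  have "V * U * (mat_adjoint U * mat_adjoint V) = V * (U * mat_adjoint U) * mat_adjoint V"
    using c a by (simp add: assoc_mult_mat[of _ d d _ d _ d])
  also have "\<dots> = 1\<^sub>m d" using assms c by (simp add: unitary_group_def)
  finally have 1: "V * U * mat_adjoint (V * U) = 1\<^sub>m d" by (simp add: adj)
  from mat_mult_left_right_inverse[OF c' mat_adjoint_carrier[OF c'] 1] 1 c'
  show ?thesis by (simp add: unitary_group_def)
qed

text \<open>Left multiplication by this matrix replaces the rows \<open>p\<close> and \<open>q\<close> by linear combinations of each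
  other, with coefficients \<open>v\<close>, and fixes all other rows. Swaps, phases and rotations of two rows are
  the only changes of variable made below.\<close>

definition row_mix :: "nat \<Rightarrow> nat \<Rightarrow> nat \<Rightarrow> (nat \<Rightarrow> nat \<Rightarrow> complex) \<Rightarrow> complex mat" where
  "row_mix d p q v = mat d d (\<lambda>(i, j).
     if i \<in> {p, q} then (if j \<in> {p, q} then v i j else 0) else if i = j then 1 else 0)"

lemma row_mix_carrier: "row_mix d p q v \<in> carrier_mat d d"
  by (simp add: row_mix_def)

lemma row_mix_mult_index:
  assumes U: "U \<in> carrier_mat d d" and pq: "p < d" "q < d" and ij: "i < d" "j < d"
  shows "(row_mix d p q v * U) $$ (i, j)
    = (if i \<in> {p, q} then \<Sum>k\<in>{p, q}. v i k * U $$ (k, j) else U $$ (i, j))"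
proof -
  have "(row_mix d p q v * U) $$ (i, j) = (\<Sum>k<d. row_mix d p q v $$ (i, k) * U $$ (k, j))"
    by (rule mat_mult_index_sum[OF row_mix_carrier U ij])
  also have "\<dots> = (if i \<in> {p, q} then \<Sum>k\<in>{p, q}. v i k * U $$ (k, j) else U $$ (i, j))"
  proof (cases "i \<in> {p, q}")
    case True
    have "(\<Sum>k<d. row_mix d p q v $$ (i, k) * U $$ (k, j)) = (\<Sum>k\<in>{p, q}. row_mix d p q v $$ (i, k) * U $$ (k, j))"
      by (rule sum.mono_neutral_right) (use True ij pq in \<open>auto simp: row_mix_def\<close>)
    also have "\<dots> = (\<Sum>k\<in>{p, q}. v i k * U $$ (k, j))"
      by (rule sum.cong) (use True ij pq in \<open>auto simp: row_mix_def\<close>)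
    finally show ?thesis using True by simp
  next
    case False
    have "(\<Sum>k<d. row_mix d p q v $$ (i, k) * U $$ (k, j)) = (\<Sum>k<d. if i = k then U $$ (k, j) else 0)"
      by (rule sum.cong) (use False ij in \<open>auto simp: row_mix_def\<close>)
    then show ?thesis using False ij by simp
  qed
  finally show ?thesis .
qed

lemma row_mix_unitary:
  assumes pq: "p < d" "q < d"
    and v: "\<And>i j. i \<in> {p, q} \<Longrightarrow> j \<in> {p, q} \<Longrightarrow>
      (\<Sum>k\<in>{p, q}. v i k * cnj (v j k)) = (if i = j then 1 else 0)"
  shows "row_mix d p q v \<in> unitary_group d"
proof -
  let ?V = "row_mix d p q v"
  note V = row_mix_carrier[of d p q v]
  note V' = mat_adjoint_carrier[OF V]
  have "?V * mat_adjoint ?V = 1\<^sub>m d"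
  proof (rule eq_matI)
    fix i j assume "i < dim_row (1\<^sub>m d :: complex mat)" "j < dim_col (1\<^sub>m d :: complex mat)"
    then have ij: "i < d" "j < d" by auto
    have adj: "mat_adjoint ?V $$ (k, j) = cnj (if j \<in> {p, q} then (if k \<in> {p, q} then v j k else 0)
        else if j = k then 1 else 0)" if "k < d" for k
      unfolding mat_adjoint_index[OF V that ij(2)] using that ij by (simp add: row_mix_def)
    show "(?V * mat_adjoint ?V) $$ (i, j) = 1\<^sub>m d $$ (i, j)"
    proof (cases "i \<in> {p, q}")
      case True
      have "(?V * mat_adjoint ?V) $$ (i, j) = (\<Sum>k\<in>{p, q}. v i k * mat_adjoint ?V $$ (k, j))"
        using True by (simp add: row_mix_mult_index[OF V' pq ij])
      also have "\<dots> = (\<Sum>k\<in>{p, q}. if j \<in> {p, q} then v i k * cnj (v j k) else 0)"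
      proof (rule sum.cong[OF refl])
        fix k assume k: "k \<in> {p, q}"
        then have "k < d" using pq by auto
        from adj[OF this] k True show "v i k * mat_adjoint ?V $$ (k, j)
            = (if j \<in> {p, q} then v i k * cnj (v j k) else 0)" by auto
      qed
      also have "\<dots> = (if j \<in> {p, q} then \<Sum>k\<in>{p, q}. v i k * cnj (v j k) else 0)" by auto
      also have "\<dots> = (if i = j then 1 else 0)" using v[OF True, of j] True by auto
      finally show ?thesis using ij by simp
    next
      case False
      then show ?thesis using ij by (auto simp: row_mix_mult_index[OF V' pq ij] adj)
    qed
  qed (use V V' in auto)
  moreover from this have "mat_adjoint ?V * ?V = 1\<^sub>m d"
    by (rule mat_mult_left_right_inverse[OF V V'])
  ultimately show ?thesis using V by (simp add: unitary_group_def)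
qed

locale unitary_haar =
  fixes d :: nat and M :: "complex mat measure"
  assumes haar: "normalized_haar d M"
begin

sublocale prob_space M
  using haar by (simp add: normalized_haar_def)

lemma sets_haar: "sets M = sets (unitary_borel d)"
  using haar by (simp add: normalized_haar_def)

lemma space_haar: "space M = unitary_group d"
  using sets_eq_imp_space_eq[OF sets_haar] by (simp add: unitary_borel_def)

lemma carrier_of_space: "U \<in> space M \<Longrightarrow> U \<in> carrier_mat d d"
  by (simp add: space_haar unitary_group_def)

lemma entry_measurable:
  assumes "i < d" "j < d"
  shows "(\<lambda>U. U $$ (i, j)) \<in> borel_measurable M"
proof -
  let ?N = "\<Pi>\<^sub>M p \<in> {..<d} \<times> {..<d}. (borel :: complex measure)"
  have "(\<lambda>U. \<lambda>p \<in> {..<d} \<times> {..<d}. U $$ p) \<in> measurable (unitary_borel d) ?N"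
    unfolding unitary_borel_def by (rule measurable_vimage_algebra1) (auto simp: space_PiM)
  moreover have "(\<lambda>f. f (i, j)) \<in> measurable ?N borel"
    by (rule measurable_component_singleton) (use assms in auto)
  ultimately have "(\<lambda>U. (\<lambda>p \<in> {..<d} \<times> {..<d}. U $$ p) (i, j)) \<in> borel_measurable (unitary_borel d)"
    by (rule measurable_compose)
  then have "(\<lambda>U. U $$ (i, j)) \<in> borel_measurable (unitary_borel d)" using assms by simp
  then show ?thesis using measurable_cong_sets[OF sets_haar refl] by blast
qed

lemma left_mult_measurable:
  assumes V: "V \<in> unitary_group d"
  shows "(\<lambda>U. V * U) \<in> measurable M M"
proof -
  have "(\<lambda>U. V * U) \<in> measurable M (unitary_borel d)"
    unfolding unitary_borel_def
  proof (rule measurable_vimage_algebra2)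
    show "(\<lambda>U. V * U) \<in> space M \<rightarrow> unitary_group d"
      using left_mult_in_unitary_group[OF V] by (simp add: space_haar)
    show "(\<lambda>U. \<lambda>p\<in>{..<d} \<times> {..<d}. (V * U) $$ p) \<in> measurable M (\<Pi>\<^sub>M p \<in> {..<d} \<times> {..<d}. borel)"
    proof (rule measurable_restrict)
      fix p assume "p \<in> {..<d} \<times> {..<d}"
      then obtain i j where p: "p = (i, j)" "i < d" "j < d" by auto
      have "(\<lambda>U. \<Sum>k<d. V $$ (i, k) * U $$ (k, j)) \<in> borel_measurable M"
        by (intro borel_measurable_sum borel_measurable_times borel_measurable_const entry_measurable)
          (use p in auto)
      moreover have "(V * U) $$ p = (\<Sum>k<d. V $$ (i, k) * U $$ (k, j))" if "U \<in> space M" for U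
        using mat_mult_index_sum[OF _ carrier_of_space[OF that] p(2,3)] V p(1)
        by (simp add: unitary_group_def)
      ultimately show "(\<lambda>U. (V * U) $$ p) \<in> borel_measurable M"
        by (subst measurable_cong)
    qed
  qed
  then show ?thesis using measurable_cong_sets[OF refl sets_haar] by blast
qed

lemma expectation_left_mult:
  fixes f :: "complex mat \<Rightarrow> complex"
  assumes V: "V \<in> unitary_group d" and f: "f \<in> borel_measurable M"
  shows "(\<integral>U. f (V * U) \<partial>M) = (\<integral>U. f U \<partial>M)"
proof -
  have "(\<integral>U. f U \<partial>M) = (\<integral>U. f U \<partial>(distr M M (\<lambda>U. V * U)))"
    using haar V by (simp add: normalized_haar_def)
  also have "\<dots> = (\<integral>U. f (V * U) \<partial>M)"
    by (rule integral_distr[OF left_mult_measurable[OF V] f])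
  finally show ?thesis ..
qed

text \<open>Measurable functions bounded by \<open>1\<close>: closed under products, hence containing all monomials in the
  matrix entries and their conjugates, and integrable for a probability measure.\<close>

definition contraction :: "(complex mat \<Rightarrow> complex) \<Rightarrow> bool" where
  "contraction f \<longleftrightarrow> f \<in> borel_measurable M \<and> (\<forall>U \<in> space M. cmod (f U) \<le> 1)"

lemma contraction_entry: "i < d \<Longrightarrow> j < d \<Longrightarrow> contraction (\<lambda>U. U $$ (i, j))"
  unfolding contraction_def by (auto intro: entry_measurable unitary_entry_norm_le_1 simp: space_haar)

lemma contraction_cnj: "contraction f \<Longrightarrow> contraction (\<lambda>U. cnj (f U))"
  unfolding contraction_def
  using measurable_compose[OF _ borel_measurable_continuous_onI[OF continuous_on_cnj[OF continuous_on_id]]]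
  by auto

lemma contraction_mult: "contraction f \<Longrightarrow> contraction g \<Longrightarrow> contraction (\<lambda>U. f U * g U)"
  unfolding contraction_def by (auto simp: norm_mult intro: mult_le_one)

lemma contraction_prod: "(\<And>i. i \<in> I \<Longrightarrow> contraction (f i)) \<Longrightarrow> contraction (\<lambda>U. \<Prod>i\<in>I. f i U)"
  unfolding contraction_def by (auto simp: prod_norm[symmetric] intro!: prod_le_1 borel_measurable_prod)

lemmas contraction_intros = contraction_entry contraction_cnj contraction_mult contraction_prod

lemma contraction_integrable: "contraction f \<Longrightarrow> integrable M f"
  unfolding contraction_def by (intro integrable_const_bound[where B = 1]) auto

text \<open>The moments \<open>T\<close> of degree two in the rows \<open>p\<close>, \<open>q\<close> and their conjugates form a tensor that is
  invariant under the unitary group of the two rows; \<open>X\<close> collects the factors from the other rows.\<close>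

lemma two_row_tensor_invariance:
  fixes v :: "nat \<Rightarrow> nat \<Rightarrow> complex"
  assumes pq: "p < d" "q < d"
    and xy: "x < d" "y < d" "x' < d" "y' < d"
    and X: "contraction X" and XV: "\<And>V U. U \<in> carrier_mat d d \<Longrightarrow> X (row_mix d p q V * U) = X U"
    and v: "\<And>i j. i \<in> {p, q} \<Longrightarrow> j \<in> {p, q} \<Longrightarrow>
      (\<Sum>k\<in>{p, q}. v i k * cnj (v j k)) = (if i = j then 1 else 0)"
    and rows: "a \<in> {p, q}" "b \<in> {p, q}" "a' \<in> {p, q}" "b' \<in> {p, q}"
  defines "T \<equiv> \<lambda>a b a' b'. \<integral>U. X U * (U $$ (a, x) * U $$ (b, y) * cnj (U $$ (a', x')) * cnj (U $$ (b', y'))) \<partial>M"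
  shows "T a b a' b' = (\<Sum>i\<in>{p, q}. \<Sum>j\<in>{p, q}. \<Sum>k\<in>{p, q}. \<Sum>l\<in>{p, q}.
      v a i * v b j * cnj (v a' k) * cnj (v b' l) * T i j k l)"
proof -
  let ?f = "\<lambda>i j k l U. X U * (U $$ (i, x) * U $$ (j, y) * cnj (U $$ (k, x')) * cnj (U $$ (l, y')))"
  let ?V = "row_mix d p q v"
  have con: "contraction (?f i j k l)"
    if "i \<in> {p, q}" "j \<in> {p, q}" "k \<in> {p, q}" "l \<in> {p, q}" for i j k l
    by (intro contraction_intros X) (use that pq xy in auto)
  have int: "integrable M (?f i j k l)"
    if "i \<in> {p, q}" "j \<in> {p, q}" "k \<in> {p, q}" "l \<in> {p, q}" for i j k l
    using that by (intro contraction_integrable con)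
  have V: "?V \<in> unitary_group d" using pq v by (rule row_mix_unitary)
  have "T a b a' b' = (\<integral>U. ?f a b a' b' (?V * U) \<partial>M)"
    unfolding T_def using con[OF rows] by (intro expectation_left_mult[OF V, symmetric]) (simp add: contraction_def)
  also have "\<dots> = (\<integral>U. (\<Sum>i\<in>{p, q}. \<Sum>j\<in>{p, q}. \<Sum>k\<in>{p, q}. \<Sum>l\<in>{p, q}.
      v a i * v b j * cnj (v a' k) * cnj (v b' l) * ?f i j k l U) \<partial>M)"
  proof (rule Bochner_Integration.integral_cong[OF refl])
    fix U assume "U \<in> space M"
    then have U: "U \<in> carrier_mat d d" by (rule carrier_of_space)
    have lt: "a < d" "b < d" "a' < d" "b' < d" using rows pq by auto
    have "?f a b a' b' (?V * U) = X U * ((\<Sum>i\<in>{p, q}. v a i * U $$ (i, x)) * (\<Sum>j\<in>{p, q}. v b j * U $$ (j, y))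
        * (\<Sum>k\<in>{p, q}. cnj (v a' k) * cnj (U $$ (k, x'))) * (\<Sum>l\<in>{p, q}. cnj (v b' l) * cnj (U $$ (l, y'))))"
      using rows by (simp only: XV[OF U] row_mix_mult_index[OF U pq] lt xy if_True cnj_sum complex_cnj_mult)
    also have "\<dots> = (\<Sum>i\<in>{p, q}. \<Sum>j\<in>{p, q}. \<Sum>k\<in>{p, q}. \<Sum>l\<in>{p, q}.
        X U * ((v a i * U $$ (i, x)) * (v b j * U $$ (j, y))
          * (cnj (v a' k) * cnj (U $$ (k, x'))) * (cnj (v b' l) * cnj (U $$ (l, y')))))"
      by (simp only: sum_distrib_left[symmetric] sum_distrib_right[symmetric])
    also have "\<dots> = (\<Sum>i\<in>{p, q}. \<Sum>j\<in>{p, q}. \<Sum>k\<in>{p, q}. \<Sum>l\<in>{p, q}.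
      v a i * v b j * cnj (v a' k) * cnj (v b' l) * ?f i j k l U)"
      by (simp only: mult_ac)
    finally show "?f a b a' b' (?V * U) = \<dots>" .
  qed
  also have "\<dots> = (\<Sum>i\<in>{p, q}. \<Sum>j\<in>{p, q}. \<Sum>k\<in>{p, q}. \<Sum>l\<in>{p, q}.
      v a i * v b j * cnj (v a' k) * cnj (v b' l) * T i j k l)"
    unfolding T_def
    by (subst Bochner_Integration.integral_sum, (intro Bochner_Integration.integrable_sum integrable_mult_right int; assumption), rule sum.cong[OF refl])+
      (simp add: int)
  finally show ?thesis .
qed


text \<open>An invariant tensor of this kind is a combination of \<open>\<delta>(a, a') \<delta>(b, b')\<close> and
  \<open>\<delta>(a, b') \<delta>(b, a')\<close>, so its value at four equal indices is the sum of the two coefficients. Three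
  substitutions suffice to see this: a phase in one row kills all entries in which the rows do not
  balance against the conjugated rows, a swap identifies the balanced entries in pairs, and a rotation by
  45 degrees yields the remaining linear relation.\<close>

lemma two_row_coincidence:
  assumes pq: "p < d" "q < d" "p \<noteq> q"
    and xy: "x < d" "y < d" "x' < d" "y' < d"
    and X: "contraction X" and XV: "\<And>V U. U \<in> carrier_mat d d \<Longrightarrow> X (row_mix d p q V * U) = X U"
  defines "T \<equiv> \<lambda>a b a' b'. \<integral>U. X U * (U $$ (a, x) * U $$ (b, y) * cnj (U $$ (a', x')) * cnj (U $$ (b', y'))) \<partial>M"
  shows "T q q q q = T p q p q + T p q q p"
proof -
  have inv: "T a b a' b' = (\<Sum>i\<in>{p, q}. \<Sum>j\<in>{p, q}. \<Sum>k\<in>{p, q}. \<Sum>l\<in>{p, q}.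
      v a i * v b j * cnj (v a' k) * cnj (v b' l) * T i j k l)"
    if "\<And>i j. i \<in> {p, q} \<Longrightarrow> j \<in> {p, q} \<Longrightarrow>
        (\<Sum>k\<in>{p, q}. v i k * cnj (v j k)) = (if i = j then 1 else 0)"
      and "a \<in> {p, q}" "b \<in> {p, q}" "a' \<in> {p, q}" "b' \<in> {p, q}"
    for v :: "nat \<Rightarrow> nat \<Rightarrow> complex" and a b a' b'
    unfolding T_def by (rule two_row_tensor_invariance[OF pq(1,2) xy X XV that])
  define w where "w i = (if i = p then \<i> else 1)" for i
  have phase: "T a b a' b' = 0"
    if "a \<in> {p, q}" "b \<in> {p, q}" "a' \<in> {p, q}" "b' \<in> {p, q}"
      and ne: "w a * w b * cnj (w a') * cnj (w b') \<noteq> 1"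
    for a b a' b'
  proof -
    let ?v = "\<lambda>i k. if i = k then w i else 0"
    have "T a b a' b' = (\<Sum>i\<in>{p, q}. \<Sum>j\<in>{p, q}. \<Sum>k\<in>{p, q}. \<Sum>l\<in>{p, q}.
        ?v a i * ?v b j * cnj (?v a' k) * cnj (?v b' l) * T i j k l)"
      by (rule inv) (use that(1-4) pq in \<open>auto simp: w_def\<close>)
    also have "\<dots> = w a * w b * cnj (w a') * cnj (w b') * T a b a' b'"
      using that(1-4) pq by auto
    finally have "T a b a' b' = w a * w b * cnj (w a') * cnj (w b') * T a b a' b'" .
    then show ?thesis using ne by (metis mult_cancel_right1)
  qed
  have unbalanced: "T p p p q = 0" "T p p q p = 0" "T p q p p = 0" "T q p p p = 0"
      "T q q q p = 0" "T q q p q = 0" "T q p q q = 0" "T p q q q = 0"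
      "T p p q q = 0" "T q q p p = 0"
    by (rule phase; use pq in \<open>simp add: w_def complex_eq_iff\<close>)+
  have swap: "T q q q q = T p p p p" "T q p q p = T p q p q" "T q p p q = T p q q p"
  proof -
    let ?v = "\<lambda>i k. if i = k then 0 else 1 :: complex"
    have v: "(\<Sum>k\<in>{p, q}. ?v i k * cnj (?v j k)) = (if i = j then 1 else 0)"
      if "i \<in> {p, q}" "j \<in> {p, q}" for i j using that pq by auto
    show "T q q q q = T p p p p" "T q p q p = T p q p q" "T q p p q = T p q q p"
      using inv[OF v, of q q q q] inv[OF v, of q p q p] inv[OF v, of q p p q] pq by auto
  qed
  define s :: complex where "s = of_real (1 / sqrt 2)"
  have "s * s = of_real (1 / sqrt 2 * (1 / sqrt 2))" by (simp only: s_def of_real_mult)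
  also have "\<dots> = 1 / 2" by simp
  finally have s: "s * s = 1 / 2" "cnj s = s" by (simp_all add: s_def)
  have "2 * (s * s) = 1" unfolding s(1) by simp
  define v where "v i k = (if i = q \<and> k = p then - s else s)" for i k
  have v: "v p p = s" "v p q = s" "v q p = - s" "v q q = s" using pq by (auto simp: v_def)
  have "T p q p q = (\<Sum>i\<in>{p, q}. \<Sum>j\<in>{p, q}. \<Sum>k\<in>{p, q}. \<Sum>l\<in>{p, q}.
      v p i * v q j * cnj (v p k) * cnj (v q l) * T i j k l)"
  proof (rule inv)
    fix i j assume "i \<in> {p, q}" "j \<in> {p, q}"
    then show "(\<Sum>k\<in>{p, q}. v i k * cnj (v j k)) = (if i = j then 1 else 0)"
      using pq s(2) \<open>2 * (s * s) = 1\<close> by (auto simp: v)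
  qed auto
  also have "\<dots> = (s * s) * (s * s) * (T p q p q - T p q q p - T q p p q + T q p q p + T p p p p + T q q q q)"
    using pq by (simp add: v s(2) unbalanced algebra_simps)
  also have "\<dots> = (T p q p q - T p q q p + T q q q q) / 2"
    unfolding s(1) swap by (simp add: field_simps)
  finally show ?thesis by (simp add: field_simps)
qed

text \<open>The Weingarten integral for an arbitrary set \<open>S\<close> of indices instead of \<open>{1..n}\<close>. The
  orthogonality relation removes an arbitrary index from \<open>S\<close>, and this freedom is what makes
  conjugation invariance provable by induction.\<close>

definition weingarten_on :: "nat set \<Rightarrow> (nat \<Rightarrow> nat) \<Rightarrow> complex" where
  "weingarten_on S \<sigma> = (\<integral>U. (\<Prod>i\<in>S. U $$ (i - 1, i - 1) * cnj (U $$ (i - 1, \<sigma> i - 1))) \<partial>M)"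

lemma weingarten_eq_weingarten_on:
  "\<sigma> permutes {1..n} \<Longrightarrow> weingarten n M \<sigma> = weingarten_on {1..n} \<sigma>"
  by (simp add: weingarten_def weingarten_on_def prod.distrib)

lemma weingarten_on_empty: "weingarten_on {} \<sigma> = 1"
  by (simp add: weingarten_on_def prob_space)

text \<open>Let the factor \<open>U\<^bsub>pp\<^esub> cnj U\<^bsub>p \<sigma>(p)\<^esub>\<close> of the integrand take its row from an arbitrary \<open>k \<in> {1..d}\<close>
  and sum over \<open>k\<close>. Orthonormality of the columns evaluates the sum to the right hand side. On the other
  hand, if no other factor uses the row \<open>k\<close>, exchanging the rows \<open>k\<close> and \<open>p\<close> shows that the integral
  is the original one; and if \<open>k = q\<close> is also the row of another factor, the coincidence formula for two
  rows gives the original integral plus the one for \<open>\<sigma> \<circ> (p q)\<close>.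

  In the group algebra, for \<open>S = {1..n}\<close> and \<open>p = n\<close>, the relation says that multiplication by
  \<open>d + J\<^sub>n\<close> takes the Weingarten function of \<open>S(n)\<close> to that of \<open>S(n - 1)\<close>.\<close>

proposition weingarten_orthogonality:
  assumes S: "S \<subseteq> {1..d}" and \<sigma>: "\<sigma> permutes S" and p: "p \<in> S"
  shows "of_nat d * weingarten_on S \<sigma>
      + (\<Sum>q\<in>S - {p}. weingarten_on S (\<sigma> \<circ> Transposition.transpose p q))
    = (if \<sigma> p = p then weingarten_on (S - {p}) \<sigma> else 0)"
proof -
  define R where "R = S - {p}"
  define e where "e U i j = U $$ (i - 1, j - 1)" for U :: "complex mat" and i j :: nat
  define P where "P A U = (\<Prod>i\<in>A. e U i i * cnj (e U i (\<sigma> i)))" for A U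
  have fin: "finite S" using S finite_subset by blast
  have \<sigma>S: "\<sigma> i \<in> S" if "i \<in> S" for i using permutes_in_image[OF \<sigma>] that by blast
  have idx: "i - 1 < d" if "i \<in> S" for i using subsetD[OF S that] by auto
  have con_e: "contraction (\<lambda>U. e U i j)" if "i \<in> {1..d}" "j \<in> {1..d}" for i j
    unfolding e_def by (rule contraction_entry) (use that in auto)
  have inS: "i \<in> {1..d}" if "i \<in> S" for i using that S by auto
  have con_P: "contraction (P A)" if "A \<subseteq> S" for A
    unfolding P_def by (intro contraction_intros con_e) (use that inS \<sigma>S in blast)+
  have mix_P: "P A (row_mix d (a - 1) (b - 1) V * U) = P A U"
    if "A \<subseteq> S - {a, b}" "a \<in> {1..d}" "b \<in> {1..d}" "U \<in> carrier_mat d d" for A a b V U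
    unfolding P_def e_def
  proof (rule prod.cong[OF refl])
    fix i assume "i \<in> A"
    then have i: "i \<in> S" "i \<noteq> a" "i \<noteq> b" using that by auto
    have ne: "i - 1 \<notin> {a - 1, b - 1}" using i inS[OF i(1)] that by auto
    have lt: "a - 1 < d" "b - 1 < d" using that by auto
    have "(row_mix d (a - 1) (b - 1) V * U) $$ (i - 1, j - 1) = U $$ (i - 1, j - 1)" if "j \<in> S" for j
      using row_mix_mult_index[OF \<open>U \<in> carrier_mat d d\<close> lt idx[OF i(1)] idx[OF that]] ne by simp
    then show "(row_mix d (a - 1) (b - 1) V * U) $$ (i - 1, i - 1)
          * cnj ((row_mix d (a - 1) (b - 1) V * U) $$ (i - 1, \<sigma> i - 1))
        = U $$ (i - 1, i - 1) * cnj (U $$ (i - 1, \<sigma> i - 1))"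
      using i(1) \<sigma>S by simp
  qed
  define I where "I k = (\<integral>U. P R U * (e U k p * cnj (e U k (\<sigma> p))) \<partial>M)" for k
  have W: "weingarten_on S \<sigma> = I p"
    unfolding weingarten_on_def I_def P_def e_def R_def
    by (subst prod.remove[OF fin p]) (simp add: mult.commute)
  \<comment> \<open>Rows that occur in no other factor.\<close>
  have fresh: "I k = weingarten_on S \<sigma>" if k: "k \<in> {1..d}" "k \<notin> R" for k
  proof (cases "k = p")
    case True
    then show ?thesis using W by simp
  next
    case False
    let ?v = "\<lambda>i j. if i = j then 0 else 1 :: complex"
    let ?V = "row_mix d (p - 1) (k - 1) ?v"
    have ne: "p - 1 \<noteq> k - 1" using False k inS[OF p] by auto
    have lt: "p - 1 < d" "k - 1 < d" using k idx[OF p] by auto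
    have V: "?V \<in> unitary_group d" by (rule row_mix_unitary[OF lt]) (use ne in auto)
    have "I p = (\<integral>U. P R (?V * U) * (e (?V * U) p p * cnj (e (?V * U) p (\<sigma> p))) \<partial>M)"
      unfolding I_def
    proof (rule expectation_left_mult[OF V, symmetric])
      have "contraction (\<lambda>U. P R U * (e U p p * cnj (e U p (\<sigma> p))))"
        by (intro contraction_intros con_e con_P) (use inS p \<sigma>S in \<open>auto simp: R_def\<close>)
      then show "(\<lambda>U. P R U * (e U p p * cnj (e U p (\<sigma> p)))) \<in> borel_measurable M"
        by (simp add: contraction_def)
    qed
    also have "\<dots> = I k"
      unfolding I_def
    proof (rule Bochner_Integration.integral_cong[OF refl])
      fix U assume "U \<in> space M"
      then have U: "U \<in> carrier_mat d d" by (rule carrier_of_space)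
      have "P R (?V * U) = P R U"
        by (rule mix_P) (use k inS[OF p] U in \<open>auto simp: R_def\<close>)
      moreover have "e (?V * U) p j = e U k j" if "j \<in> S" for j
        unfolding e_def using row_mix_mult_index[OF U lt lt(1) idx[OF that]] ne by simp
      ultimately show "P R (?V * U) * (e (?V * U) p p * cnj (e (?V * U) p (\<sigma> p)))
          = P R U * (e U k p * cnj (e U k (\<sigma> p)))"
        using p \<sigma>S by simp
    qed
    finally show ?thesis using W by simp
  qed
  \<comment> \<open>Rows that another factor uses as well.\<close>
  have repeated: "I q = weingarten_on S \<sigma> + weingarten_on S (\<sigma> \<circ> Transposition.transpose p q)"
    if q: "q \<in> R" for q
  proof -
    have qS: "q \<in> S" "q \<noteq> p" using q by (auto simp: R_def)
    have pq: "p - 1 < d" "q - 1 < d" "p - 1 \<noteq> q - 1"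
      using idx[OF p] idx[OF qS(1)] qS inS[OF p] inS[OF qS(1)] by auto
    have xy: "\<sigma> p - 1 < d" "\<sigma> q - 1 < d" using idx \<sigma>S p qS by auto
    define X where "X = P (S - {p, q})"
    have X: "contraction X" unfolding X_def by (rule con_P) auto
    have XV: "X (row_mix d (p - 1) (q - 1) V * U) = X U" if "U \<in> carrier_mat d d" for V U
      unfolding X_def by (rule mix_P) (use that inS p qS in auto)
    note two_row_coincidence[OF pq(1-3) pq(1,2) xy X XV]
    moreover have "I q = (\<integral>U. X U * (U $$ (q - 1, p - 1) * U $$ (q - 1, q - 1)
        * cnj (U $$ (q - 1, \<sigma> p - 1)) * cnj (U $$ (q - 1, \<sigma> q - 1))) \<partial>M)"
    proof -
      have Rq: "R - {q} = S - {p, q}" by (auto simp: R_def)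
      have "P R U = e U q q * cnj (e U q (\<sigma> q)) * X U" for U
        unfolding P_def X_def Rq[symmetric] using q fin by (subst prod.remove[of R q]) (auto simp: R_def)
      then show ?thesis unfolding I_def e_def by (simp add: mult_ac)
    qed
    moreover have "weingarten_on S \<sigma> = (\<integral>U. X U * (U $$ (p - 1, p - 1) * U $$ (q - 1, q - 1)
        * cnj (U $$ (p - 1, \<sigma> p - 1)) * cnj (U $$ (q - 1, \<sigma> q - 1))) \<partial>M)"
    proof -
      have Sq: "S - {p} - {q} = S - {p, q}" by auto
      show ?thesis
        unfolding weingarten_on_def X_def P_def e_def Sq[symmetric]
        by (subst prod.remove[OF fin p], subst prod.remove[of _ q]) (use fin qS in \<open>auto simp: mult_ac\<close>)
    qed
    moreover have "weingarten_on S (\<sigma> \<circ> Transposition.transpose p q)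
      = (\<integral>U. X U * (U $$ (p - 1, p - 1) * U $$ (q - 1, q - 1)
        * cnj (U $$ (q - 1, \<sigma> p - 1)) * cnj (U $$ (p - 1, \<sigma> q - 1))) \<partial>M)"
    proof -
      let ?\<tau> = "\<sigma> \<circ> Transposition.transpose p q"
      have Sq: "S - {p} - {q} = S - {p, q}" by auto
      have X\<tau>: "X U = (\<Prod>i\<in>S - {p} - {q}. U $$ (i - 1, i - 1) * cnj (U $$ (i - 1, ?\<tau> i - 1)))" for U
        unfolding X_def P_def e_def Sq by (rule prod.cong) auto
      show ?thesis
        unfolding weingarten_on_def X\<tau>
        by (subst prod.remove[OF fin p], subst prod.remove[of _ q]) (use fin qS in \<open>auto simp: mult_ac\<close>)
    qed
    ultimately show ?thesis by simp
  qed
  have RS: "R \<subseteq> {1..d}" using S by (auto simp: R_def)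
  have finR: "finite R" using fin by (simp add: R_def)
  have "(\<Sum>k\<in>{1..d}. I k) = (\<Sum>k\<in>{1..d} - R. I k) + (\<Sum>k\<in>R. I k)"
    using RS by (intro sum.subset_diff) auto
  also have "(\<Sum>k\<in>{1..d} - R. I k) = of_nat (card ({1..d} - R)) * weingarten_on S \<sigma>"
    using fresh by simp
  also have "card ({1..d} - R) = d - card R" using RS finR by (simp add: card_Diff_subset)
  also have "(\<Sum>k\<in>R. I k) = of_nat (card R) * weingarten_on S \<sigma>
      + (\<Sum>q\<in>R. weingarten_on S (\<sigma> \<circ> Transposition.transpose p q))"
    using repeated by (simp add: sum.distrib)
  finally have "(\<Sum>k\<in>{1..d}. I k) = of_nat d * weingarten_on S \<sigma>
      + (\<Sum>q\<in>R. weingarten_on S (\<sigma> \<circ> Transposition.transpose p q))"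
    using card_mono[OF _ RS] by (simp add: of_nat_diff algebra_simps)
  moreover have "(\<Sum>k\<in>{1..d}. I k) = (if \<sigma> p = p then weingarten_on R \<sigma> else 0)"
  proof -
    have "(\<Sum>k\<in>{1..d}. I k) = (\<integral>U. (\<Sum>k\<in>{1..d}. P R U * (e U k p * cnj (e U k (\<sigma> p)))) \<partial>M)"
      unfolding I_def
      by (rule Bochner_Integration.integral_sum[symmetric], intro contraction_integrable contraction_intros con_e con_P)
        (use inS p \<sigma>S in \<open>auto simp: R_def\<close>)
    also have "\<dots> = (\<integral>U. (if \<sigma> p = p then P R U else 0) \<partial>M)"
    proof (rule Bochner_Integration.integral_cong[OF refl])
      fix U assume "U \<in> space M"
      then have U: "U \<in> unitary_group d" by (simp add: space_haar)
      have "(\<Sum>k\<in>{1..d}. e U k p * cnj (e U k (\<sigma> p))) = (\<Sum>k<d. U $$ (k, p - 1) * cnj (U $$ (k, \<sigma> p - 1)))"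
        unfolding e_def by (rule sum.reindex_bij_witness[of _ Suc "\<lambda>k. k - 1"]) auto
      also have "\<dots> = (if p - 1 = \<sigma> p - 1 then 1 else 0)"
        by (rule unitary_columns_orthonormal[OF U]) (use idx p \<sigma>S in auto)
      also have "p - 1 = \<sigma> p - 1 \<longleftrightarrow> \<sigma> p = p" using inS[OF p] inS[OF \<sigma>S[OF p]] by auto
      finally show "(\<Sum>k\<in>{1..d}. P R U * (e U k p * cnj (e U k (\<sigma> p)))) = (if \<sigma> p = p then P R U else 0)"
        by (simp add: sum_distrib_left[symmetric])
    qed
    also have "\<dots> = (if \<sigma> p = p then weingarten_on R \<sigma> else 0)"
      by (simp add: weingarten_on_def P_def e_def)
    finally show ?thesis .
  qed
  ultimately show ?thesis by (simp add: R_def)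
qed

end

section \<open>Conjugation invariance\<close>

text \<open>The orthogonality relation determines its solution: the sum has fewer than \<open>d\<close> terms, so at a
  permutation where \<open>\<bar>g\<bar>\<close> is maximal it cannot balance the diagonal term unless that maximum is zero.\<close>

lemma homogeneous_orthogonality_zero:
  fixes g :: "(nat \<Rightarrow> nat) \<Rightarrow> complex"
  assumes S: "finite S" "p \<in> S" "card S \<le> d"
    and rel: "\<And>\<sigma>. \<sigma> permutes S \<Longrightarrow>
      of_nat d * g \<sigma> + (\<Sum>q\<in>S - {p}. g (\<sigma> \<circ> Transposition.transpose p q)) = 0"
    and \<sigma>: "\<sigma> permutes S"
  shows "g \<sigma> = 0"
proof -
  let ?N = "(\<lambda>\<sigma>. cmod (g \<sigma>)) ` {\<sigma>. \<sigma> permutes S}"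
  have N: "finite ?N" "?N \<noteq> {}" using finite_permutations[OF S(1)] \<sigma> by auto
  obtain \<tau> where \<tau>: "\<tau> permutes S" "Max ?N = cmod (g \<tau>)" using Max_in[OF N] by auto
  have le: "cmod (g \<rho>) \<le> Max ?N" if "\<rho> permutes S" for \<rho> using that N by (intro Max_ge) auto
  have "of_nat d * g \<tau> = - (\<Sum>q\<in>S - {p}. g (\<tau> \<circ> Transposition.transpose p q))"
    using rel[OF \<tau>(1)] by (simp add: add_eq_0_iff2)
  then have "cmod (of_nat d * g \<tau>) = cmod (\<Sum>q\<in>S - {p}. g (\<tau> \<circ> Transposition.transpose p q))"
    by (simp only: norm_minus_cancel)
  also have "\<dots> \<le> (\<Sum>q\<in>S - {p}. Max ?N)"
    by (intro sum_norm_le le permutes_compose[OF permutes_swap_id \<tau>(1)]) (use S in auto)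
  also have "\<dots> = real (card S - 1) * Max ?N" using S by simp
  finally have "real d * Max ?N \<le> real (card S - 1) * Max ?N" by (simp add: norm_mult \<tau>(2))
  moreover have "real (card S - 1) < real d"
    using S card_gt_0_iff[of S] by (auto simp: of_nat_less_iff)
  moreover have "0 \<le> Max ?N" by (simp add: \<tau>(2))
  ultimately have "Max ?N = 0" by (smt (verit, ccfv_threshold) mult_strict_right_mono)
  then show ?thesis using le[OF \<sigma>] by simp
qed

lemma conj_permutes_image:
  assumes \<pi>: "bij \<pi>" and \<sigma>: "\<sigma> permutes S"
  shows "\<pi> \<circ> \<sigma> \<circ> inv_into UNIV \<pi> permutes \<pi> ` S"
proof -
  have inv: "inv_into UNIV \<pi> (\<pi> x) = x" for x using \<pi> by (simp add: bij_is_inj)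
  have "bij (\<pi> \<circ> \<sigma> \<circ> inv_into UNIV \<pi>)"
    using \<pi> permutes_bij[OF \<sigma>] by (intro bij_comp bij_imp_bij_inv)
  moreover have "(\<pi> \<circ> \<sigma> \<circ> inv_into UNIV \<pi>) y = y" if "y \<notin> \<pi> ` S" for y
  proof -
    obtain x where x: "y = \<pi> x" using surjD[OF bij_is_surj[OF \<pi>]] by blast
    then have "x \<notin> S" using that by auto
    then show ?thesis using x \<sigma> by (simp add: inv permutes_not_in)
  qed
  ultimately show ?thesis unfolding permutes_def bij_iff by blast
qed

lemma conj_comp_transpose:
  assumes "bij \<pi>"
  shows "\<pi> \<circ> \<sigma> \<circ> inv_into UNIV \<pi> \<circ> Transposition.transpose (\<pi> p) (\<pi> q)
    = \<pi> \<circ> (\<sigma> \<circ> Transposition.transpose p q) \<circ> inv_into UNIV \<pi>"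
proof
  fix y
  obtain x where x: "y = \<pi> x" using surjD[OF bij_is_surj[OF assms]] by blast
  have inv: "inv_into UNIV \<pi> (\<pi> x) = x" for x using assms by (simp add: bij_is_inj)
  have "Transposition.transpose (\<pi> p) (\<pi> q) (\<pi> x) = \<pi> (Transposition.transpose p q x)"
    using bij_is_inj[OF assms] by (auto simp: Transposition.transpose_def inj_eq)
  then show "(\<pi> \<circ> \<sigma> \<circ> inv_into UNIV \<pi> \<circ> Transposition.transpose (\<pi> p) (\<pi> q)) y
    = (\<pi> \<circ> (\<sigma> \<circ> Transposition.transpose p q) \<circ> inv_into UNIV \<pi>) y"
    by (simp add: x inv)
qed

context unitary_haar begin

text \<open>Both sides satisfy the same orthogonality relation, for \<open>\<pi> p\<close> in \<open>\<pi> ` S\<close> and for \<open>p\<close> in \<open>S\<close>, with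
  the same right hand side by induction; the solution is unique.\<close>

lemma weingarten_on_conj:
  assumes \<pi>: "\<pi> permutes {1..d}" and S: "S \<subseteq> {1..d}" and \<sigma>: "\<sigma> permutes S"
  shows "weingarten_on (\<pi> ` S) (\<pi> \<circ> \<sigma> \<circ> inv_into UNIV \<pi>) = weingarten_on S \<sigma>"
proof -
  have "finite S" using S finite_subset by blast
  then show ?thesis using S \<sigma>
  proof (induction S arbitrary: \<sigma> rule: finite_induct)
    case empty
    then show ?case by (simp only: image_empty weingarten_on_empty)
  next
    case (insert p F)
    let ?S = "insert p F"
    let ?c = "\<lambda>\<tau>. \<pi> \<circ> \<tau> \<circ> inv_into UNIV \<pi>"
    have bij: "bij \<pi>" using \<pi> by (rule permutes_bij)
    have inj: "inj \<pi>" using bij by (rule bij_is_inj)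
    have inv: "inv_into UNIV \<pi> (\<pi> x) = x" for x using inj by simp
    have "card ?S \<le> card {1..d}" using insert.prems(1) by (intro card_mono) auto
    then have card: "card ?S \<le> d" by simp
    have Sp: "?S - {p} = F" using insert.hyps by auto
    have \<pi>Sp: "\<pi> ` ?S - {\<pi> p} = \<pi> ` F" using inj insert.hyps by (auto simp: inj_eq)
    have \<pi>S: "\<pi> ` ?S \<subseteq> {1..d}" using permutes_image[OF \<pi>] insert.prems(1) by blast
    let ?g = "\<lambda>\<tau>. weingarten_on (\<pi> ` ?S) (?c \<tau>) - weingarten_on ?S \<tau>"
    have "?g \<sigma> = 0"
    proof (rule homogeneous_orthogonality_zero[of ?S p d ?g \<sigma>])
      show "finite ?S" "p \<in> ?S" "card ?S \<le> d" "\<sigma> permutes ?S"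
        using insert.hyps card insert.prems(2) by auto
      fix \<tau> assume \<tau>: "\<tau> permutes ?S"
      have c\<tau>: "?c \<tau> permutes \<pi> ` ?S" using bij \<tau> by (rule conj_permutes_image)
      have "of_nat d * weingarten_on (\<pi> ` ?S) (?c \<tau>)
          + (\<Sum>q\<in>\<pi> ` F. weingarten_on (\<pi> ` ?S) (?c \<tau> \<circ> Transposition.transpose (\<pi> p) q))
          = (if ?c \<tau> (\<pi> p) = \<pi> p then weingarten_on (\<pi> ` F) (?c \<tau>) else 0)"
        using weingarten_orthogonality[OF \<pi>S c\<tau>, of "\<pi> p"] unfolding \<pi>Sp by simp
      also have "(\<Sum>q\<in>\<pi> ` F. weingarten_on (\<pi> ` ?S) (?c \<tau> \<circ> Transposition.transpose (\<pi> p) q))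
          = (\<Sum>q\<in>F. weingarten_on (\<pi> ` ?S) (?c (\<tau> \<circ> Transposition.transpose p q)))"
      proof (subst sum.reindex)
        show "inj_on \<pi> F" using inj by (rule inj_on_subset) simp
        show "sum ((\<lambda>q. weingarten_on (\<pi> ` ?S) (?c \<tau> \<circ> Transposition.transpose (\<pi> p) q)) \<circ> \<pi>) F
            = (\<Sum>q\<in>F. weingarten_on (\<pi> ` ?S) (?c (\<tau> \<circ> Transposition.transpose p q)))"
          by (rule sum.cong[OF refl]) (simp only: comp_apply[of _ \<pi>] conj_comp_transpose[OF bij])
      qed
      also have "(if ?c \<tau> (\<pi> p) = \<pi> p then weingarten_on (\<pi> ` F) (?c \<tau>) else 0)
          = (if \<tau> p = p then weingarten_on F \<tau> else 0)"
      proof -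
        have "?c \<tau> (\<pi> p) = \<pi> p \<longleftrightarrow> \<tau> p = p" using inj by (simp add: inv inj_eq)
        moreover have "weingarten_on (\<pi> ` F) (?c \<tau>) = weingarten_on F \<tau>" if "\<tau> p = p"
        proof (rule insert.IH)
          show "F \<subseteq> {1..d}" using insert.prems by auto
          show "\<tau> permutes F" using \<tau> by (rule permutes_superset) (use that in auto)
        qed
        ultimately show ?thesis by (cases "\<tau> p = p") (simp_all only: if_True if_False)
      qed
      also have "\<dots> = of_nat d * weingarten_on ?S \<tau>
          + (\<Sum>q\<in>F. weingarten_on ?S (\<tau> \<circ> Transposition.transpose p q))"
        using weingarten_orthogonality[OF insert.prems(1) \<tau>, of p] unfolding Sp by simp
      finally show "of_nat d * ?g \<tau> + (\<Sum>q\<in>?S - {p}. ?g (\<tau> \<circ> Transposition.transpose p q)) = 0"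
        unfolding Sp by (simp only: sum_subtractf right_diff_distrib) (simp only: algebra_simps add_0_left)
    qed
    then show ?case by (simp only: right_minus_eq)
  qed
qed

end

section \<open>Expansion of the Weingarten function in Jucys-Murphy elements\<close>

text \<open>The coefficient of \<open>\<sigma>\<close> in the terms of \<open>(d + J\<^sub>1)\<^sup>-\<^sup>1 \<cdots> (d + J\<^sub>n)\<^sup>-\<^sup>1\<close>, expanded in
  powers of \<open>1 / d\<close>.\<close>

definition jucys_series :: "nat \<Rightarrow> nat \<Rightarrow> (nat \<Rightarrow> nat) \<Rightarrow> nat \<Rightarrow> complex" where
  "jucys_series d n \<sigma> s = (-1) ^ s * h_coeff n s \<sigma> / of_nat d ^ (n + s)"

lemma summable_jucys_series:
  assumes "n ^ 2 < d"
  shows "summable (jucys_series d n \<sigma>)"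
proof (rule summable_comparison_test)
  let ?q = "real (n ^ 2) / real d"
  have d: "0 < d" using assms by linarith
  have "norm ?q < 1" using assms d by (simp add: of_nat_less_iff del: of_nat_power)
  then show "summable (\<lambda>s. (1 / real d ^ n) * ?q ^ s)" by (intro summable_mult summable_geometric)
  show "\<exists>N. \<forall>s\<ge>N. norm (jucys_series d n \<sigma> s) \<le> (1 / real d ^ n) * ?q ^ s"
  proof (intro exI allI impI)
    fix s
    have "norm (jucys_series d n \<sigma> s) = cmod (h_coeff n s \<sigma>) / real d ^ (n + s)"
      by (simp add: jucys_series_def norm_mult norm_divide norm_power)
    also have "\<dots> \<le> real n ^ (2 * s) / real d ^ (n + s)"
      by (intro divide_right_mono norm_h_coeff_le) simp
    also have "\<dots> = (1 / real d ^ n) * ?q ^ s"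
      by (simp add: power_add power_mult power_divide)
    finally show "norm (jucys_series d n \<sigma> s) \<le> (1 / real d ^ n) * ?q ^ s" .
  qed
qed

text \<open>Multiplying by \<open>d + J\<^bsub>n+1\<^esub>\<close> cancels the last factor. Termwise this is the recursion for \<open>h\<^sub>r\<close>, the
  shift in \<open>r\<close> being compensated by the factor \<open>d\<close>.\<close>

lemma jucys_series_recursion:
  assumes "Suc n ^ 2 < d"
  shows "of_nat d * suminf (jucys_series d (Suc n) \<sigma>)
      + (\<Sum>k = 1..n. suminf (jucys_series d (Suc n) (\<sigma> \<circ> Transposition.transpose (Suc n) k)))
    = suminf (jucys_series d n \<sigma>)"
proof -
  let ?t = "\<lambda>k. \<sigma> \<circ> Transposition.transpose (Suc n) k"
  have d: "(of_nat d :: complex) \<noteq> 0" using assms by auto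
  have "n ^ 2 \<le> Suc n ^ 2" by (rule power_mono) auto
  then have sn: "summable (jucys_series d n \<sigma>)" using assms by (intro summable_jucys_series) linarith
  have sSuc: "summable (jucys_series d (Suc n) \<tau>)" for \<tau> using assms by (rule summable_jucys_series)
  have head: "of_nat d * jucys_series d (Suc n) \<sigma> 0 = jucys_series d n \<sigma> 0"
    using d by (simp add: jucys_series_def)
  have tail: "of_nat d * jucys_series d (Suc n) \<sigma> (Suc s)
      = jucys_series d n \<sigma> (Suc s) - (\<Sum>k = 1..n. jucys_series d (Suc n) (?t k) s)" for s
  proof -
    have "of_nat d * jucys_series d (Suc n) \<sigma> (Suc s)
        = (-1) ^ Suc s * (h_coeff n (Suc s) \<sigma> + (\<Sum>k = 1..n. h_coeff (Suc n) s (?t k))) / of_nat d ^ (n + Suc s)"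
      unfolding jucys_series_def h_coeff.simps using d by (simp add: divide_simps)
    also have "\<dots> = jucys_series d n \<sigma> (Suc s)
        - (\<Sum>k = 1..n. (-1) ^ s * h_coeff (Suc n) s (?t k) / of_nat d ^ (n + Suc s))"
      unfolding jucys_series_def sum_distrib_left[symmetric] sum_divide_distrib[symmetric]
      by (simp add: distrib_left add_divide_distrib diff_divide_distrib)
    finally show ?thesis unfolding jucys_series_def add_Suc_shift .
  qed
  have "of_nat d * suminf (jucys_series d (Suc n) \<sigma>) = (\<Sum>s. of_nat d * jucys_series d (Suc n) \<sigma> s)"
    by (rule suminf_mult[OF sSuc, symmetric])
  also have "\<dots> = (\<Sum>s. of_nat d * jucys_series d (Suc n) \<sigma> (Suc s)) + of_nat d * jucys_series d (Suc n) \<sigma> 0"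
    using suminf_split_head[OF summable_mult[OF sSuc, of "of_nat d" \<sigma>]] by simp
  also have "(\<Sum>s. of_nat d * jucys_series d (Suc n) \<sigma> (Suc s))
      = (\<Sum>s. jucys_series d n \<sigma> (Suc s)) - (\<Sum>s. \<Sum>k = 1..n. jucys_series d (Suc n) (?t k) s)"
    unfolding tail
    by (rule suminf_diff[symmetric]) (use sn sSuc in \<open>auto simp: summable_Suc_iff intro!: summable_sum\<close>)
  also have "(\<Sum>s. \<Sum>k = 1..n. jucys_series d (Suc n) (?t k) s)
      = (\<Sum>k = 1..n. suminf (jucys_series d (Suc n) (?t k)))"
    by (rule suminf_sum) (rule sSuc)
  also have "(\<Sum>s. jucys_series d n \<sigma> (Suc s)) = suminf (jucys_series d n \<sigma>) - jucys_series d n \<sigma> 0"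
    using suminf_split_head[OF sn] by simp
  finally have "of_nat d * suminf (jucys_series d (Suc n) \<sigma>)
      = suminf (jucys_series d n \<sigma>) - jucys_series d n \<sigma> 0
        - (\<Sum>k = 1..n. suminf (jucys_series d (Suc n) (?t k))) + jucys_series d n \<sigma> 0"
    unfolding head .
  moreover have "x + c = b" if "x = b - y - c + y" for x y b c :: complex
    using that by simp
  ultimately show ?thesis by blast
qed

context unitary_haar begin

text \<open>Weingarten integral and series obey the same recursion in \<open>n\<close>, which has only one solution. On
  permutations that move \<open>n + 1\<close>, both right hand sides vanish, the one for the series because
  \<open>h\<^sub>r(J\<^sub>1, \<dots>, J\<^sub>n)\<close> is supported on \<open>S(n)\<close>.\<close>

lemma weingarten_on_eq_jucys_series:
  assumes "n ^ 2 < d" and "\<sigma> permutes {1..n}"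
  shows "weingarten_on {1..n} \<sigma> = suminf (jucys_series d n \<sigma>)"
  using assms
proof (induction n arbitrary: \<sigma>)
  case 0
  then have "\<sigma> = id" by simp
  then have "jucys_series d 0 \<sigma> = (\<lambda>s. if s = 0 then 1 else 0)"
    by (intro ext) (metis (no_types, lifting) jucys_series_def h_coeff.simps(1,2) add_0 div_by_1 mult_1
        mult_zero_right div_0 not0_implies_Suc power_0)
  then show ?case using sums_unique[OF sums_single[of 0 "\<lambda>_. 1 :: complex"]]
    by (simp add: weingarten_on_empty)
next
  case (Suc n)
  let ?S = "{1..Suc n}"
  let ?g = "\<lambda>\<sigma>. weingarten_on ?S \<sigma> - suminf (jucys_series d (Suc n) \<sigma>)"
  have "n ^ 2 \<le> Suc n ^ 2" "Suc n * 1 \<le> Suc n * Suc n" by (rule power_mono) auto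
  then have d: "n ^ 2 < d" "Suc n \<le> d" using Suc.prems(1) by (auto simp: power2_eq_square)
  have Sn: "?S - {Suc n} = {1..n}" by auto
  have "?g \<sigma> = 0"
  proof (rule homogeneous_orthogonality_zero[of ?S "Suc n" d ?g \<sigma>])
    show "finite ?S" "Suc n \<in> ?S" "card ?S \<le> d" "\<sigma> permutes ?S" using d Suc.prems by auto
    fix \<tau> assume \<tau>: "\<tau> permutes ?S"
    have S: "?S \<subseteq> {1..d}" using d by auto
    have "of_nat d * weingarten_on ?S \<tau>
        + (\<Sum>q\<in>{1..n}. weingarten_on ?S (\<tau> \<circ> Transposition.transpose (Suc n) q))
        = (if \<tau> (Suc n) = Suc n then weingarten_on {1..n} \<tau> else 0)"
      using weingarten_orthogonality[OF S \<tau>, of "Suc n"] unfolding Sn by simp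
    also have "\<dots> = suminf (jucys_series d n \<tau>)"
    proof (cases "\<tau> (Suc n) = Suc n")
      case True
      have "\<tau> permutes {1..n}"
        by (rule permutes_superset[OF \<tau>]) (use True in \<open>auto simp: le_Suc_eq\<close>)
      then show ?thesis using True Suc.IH d by simp
    next
      case False
      then have "\<not> \<tau> permutes {1..n}" by (auto simp: permutes_not_in)
      then have "h_coeff n s \<tau> = 0" for s using h_coeff_permutes by blast
      then have "jucys_series d n \<tau> = (\<lambda>_. 0)" by (auto simp: jucys_series_def)
      then show ?thesis using False by simp
    qed
    also have "\<dots> = of_nat d * suminf (jucys_series d (Suc n) \<tau>)
        + (\<Sum>q = 1..n. suminf (jucys_series d (Suc n) (\<tau> \<circ> Transposition.transpose (Suc n) q)))"
      using jucys_series_recursion[OF Suc.prems(1), of \<tau>] by simp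
    finally show "of_nat d * ?g \<tau> + (\<Sum>q\<in>?S - {Suc n}. ?g (\<tau> \<circ> Transposition.transpose (Suc n) q)) = 0"
      unfolding Sn by (simp only: sum_subtractf right_diff_distrib) (simp only: algebra_simps add_0_left)
  qed
  then show ?case by (simp only: right_minus_eq)
qed

end

text \<open>Agreement at all large integers \<open>d\<close> is agreement of two power series at the points \<open>1 / d\<close>, which
  accumulate at \<open>0\<close>. Dividing the difference by its lowest power leaves a series that tends to its
  nonzero constant term but vanishes at all these points.\<close>

lemma inverse_power_series_unique:
  fixes a b :: "nat \<Rightarrow> complex" and N n :: nat
  assumes "\<And>d. d \<ge> N \<Longrightarrow> (\<lambda>s. a s / of_nat d ^ (n + s)) sums F d"
    and "\<And>d. d \<ge> N \<Longrightarrow> (\<lambda>s. b s / of_nat d ^ (n + s)) sums F d"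
  shows "a = b"
proof (rule ccontr)
  assume "a \<noteq> b"
  then have "\<exists>s. a s - b s \<noteq> 0" unfolding fun_eq_iff by simp
  define m where "m = (LEAST s. a s - b s \<noteq> 0)"
  have m: "a m - b m \<noteq> 0"
    unfolding m_def by (rule LeastI_ex) fact
  have below: "a s - b s = 0" if "s < m" for s
    using not_less_Least[OF that[unfolded m_def]] by blast
  define c where "c s = a (s + m) - b (s + m)" for s
  have zero: "(\<lambda>s. c s * (1 / of_nat d) ^ s) sums 0" if d: "d \<ge> Suc N" for d
  proof -
    have d0: "(of_nat d :: complex) \<noteq> 0" using d by auto
    have "(\<lambda>s. a s / of_nat d ^ (n + s) - b s / of_nat d ^ (n + s)) sums (F d - F d)"
      using assms[of d] d by (intro sums_diff) auto
    then have "(\<lambda>s. (a s - b s) / of_nat d ^ (n + s)) sums 0" by (simp add: diff_divide_distrib)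
    then have "(\<lambda>s. (a (s + m) - b (s + m)) / of_nat d ^ (n + (s + m))) sums 0"
      using sums_iff_shift[of "\<lambda>s. (a s - b s) / of_nat d ^ (n + s)" m 0] below by simp
    then have "(\<lambda>s. of_nat d ^ (n + m) * ((a (s + m) - b (s + m)) / of_nat d ^ (n + (s + m)))) sums (of_nat d ^ (n + m) * 0)"
      by (rule sums_mult)
    moreover have "of_nat d ^ (n + m) * ((a (s + m) - b (s + m)) / of_nat d ^ (n + (s + m)))
        = c s * (1 / of_nat d) ^ s" for s
      using d0 by (simp add: c_def power_add power_divide field_simps)
    ultimately show ?thesis by simp
  qed
  define f where "f x = (\<Sum>s. c s * x ^ s)" for x
  have "(f \<longlongrightarrow> c 0) (at 0)"
  proof (rule powser_limit_0)
    show "0 < 1 / real (Suc N)" by simp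
    fix x :: complex assume "norm x < 1 / real (Suc N)"
    then have "norm x < norm (1 / of_nat (Suc N) :: complex)" by (simp only: norm_divide norm_one norm_of_nat)
    then have "summable (\<lambda>s. c s * x ^ s)"
      by (rule powser_inside[OF sums_summable[OF zero[of "Suc N"]], rotated]) simp
    then show "(\<lambda>s. c s * x ^ s) sums f x" unfolding f_def by (rule summable_sums)
  qed
  moreover have "filterlim (\<lambda>d. 1 / of_nat d :: complex) (at 0) sequentially"
    unfolding filterlim_at
    using lim_1_over_n eventually_gt_at_top[of 0] by (auto elim: eventually_mono)
  ultimately have "((\<lambda>d. f (1 / of_nat d)) \<longlongrightarrow> c 0) sequentially"
    by (rule filterlim_compose)
  moreover have "eventually (\<lambda>d. f (1 / of_nat d) = 0) sequentially"
    using eventually_ge_at_top[of "Suc N"]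
    by eventually_elim (use zero in \<open>auto simp: f_def sums_iff\<close>)
  then have "((\<lambda>d. f (1 / of_nat d)) \<longlongrightarrow> 0) sequentially" by (rule tendsto_eventually)
  ultimately have "c 0 = 0" by (rule LIMSEQ_unique)
  then show False using m by (simp add: c_def)
qed

section \<open>The class expansion\<close>

text \<open>A sum over the class basis, evaluated at one permutation, has at most one nonzero term.\<close>

lemma sum_class_sum:
  "(\<Sum>\<mu> | \<mu> \<in> partitions n \<and> Q \<mu>. c \<mu> * class_sum n \<mu> \<sigma>)
    = (if \<sigma> permutes {1..n} \<and> Q (cycle_type n \<sigma>) then c (cycle_type n \<sigma>) else 0)"
proof -
  have "(\<Sum>\<mu> | \<mu> \<in> partitions n \<and> Q \<mu>. c \<mu> * class_sum n \<mu> \<sigma>)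
      = (\<Sum>\<mu> | \<mu> \<in> partitions n \<and> Q \<mu>. if \<mu> = cycle_type n \<sigma> then
          (if \<sigma> permutes {1..n} then c (cycle_type n \<sigma>) else 0) else 0)"
    by (rule sum.cong) (auto simp: class_sum_def)
  also have "\<dots> = (if cycle_type n \<sigma> \<in> partitions n \<and> Q (cycle_type n \<sigma>) then
      (if \<sigma> permutes {1..n} then c (cycle_type n \<sigma>) else 0) else 0)"
    by (subst sum.delta) (simp_all add: finite_partitions)
  finally show ?thesis using cycle_type_in_partitions by auto
qed

lemma infsum_single_index:
  fixes x :: complex and L b m :: int
  shows "(\<Sum>\<^sub>\<infinity>g \<in> {m..}. if Q \<and> L = b + 2 * g then x else 0)
    = (if Q \<and> (\<exists>g\<ge>m. L = b + 2 * g) then x else 0)"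
proof (cases "Q \<and> (\<exists>g\<ge>m. L = b + 2 * g)")
  case True
  then obtain g where g: "Q" "g \<ge> m" "L = b + 2 * g" by auto
  have "(\<Sum>\<^sub>\<infinity>g \<in> {m..}. if Q \<and> L = b + 2 * g then x else 0) = (\<Sum>\<^sub>\<infinity>g' \<in> {g}. x)"
    by (rule infsum_cong_neutral) (use g in auto)
  then show ?thesis using True by simp
next
  case False
  then have "(\<Sum>\<^sub>\<infinity>g \<in> {m..}. if Q \<and> L = b + 2 * g then x else 0) = 0"
    by (intro infsum_0) auto
  then show ?thesis by (simp only: False if_False)
qed

theorem corollary2p5:
  fixes n r :: nat
    and H :: "nat \<Rightarrow> complex mat measure"
    and a :: "nat \<Rightarrow> (nat \<Rightarrow> nat) \<Rightarrow> complex"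
  assumes "n \<ge> 1"
    and haar: "\<And>d. d \<ge> n \<Longrightarrow> normalized_haar d (H d)"
    and central: "\<And>s. a s \<in> center_CS n"
    and expansion: "\<And>d \<mu>. d \<ge> n \<Longrightarrow> \<mu> \<in> partitions n \<Longrightarrow>
          (\<lambda>s. class_value n (a s) \<mu> / of_nat d ^ (n + s)) sums class_value n (weingarten n (H d)) \<mu>"
  shows "complete_homogeneous (CS n) n r jucys_murphy =
      (\<lambda>\<sigma>. (-1) ^ r *
        (\<Sum>\<^sub>\<infinity>g \<in> {0::int..}. \<Sum>\<mu> | \<mu> \<in> partitions n \<and> int (size \<mu>) = int n - int r + 2 * g.
            class_value n (a r) \<mu> * class_sum n \<mu> \<sigma>))
    \<and> (n > r \<and> r \<ge> 1 \<longrightarrow>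
      complete_homogeneous (CS n) n r jucys_murphy =
      (\<lambda>\<sigma>. (-1) ^ r *
        (\<Sum>\<mu> | \<mu> \<in> partitions n \<and> int (size \<mu>) = int n - int r.
            Moeb \<mu> * class_sum n \<mu> \<sigma>)
        + (-1) ^ r *
        (\<Sum>\<^sub>\<infinity>g \<in> {1::int..}. \<Sum>\<nu> | \<nu> \<in> partitions n \<and> int (size \<nu>) = int n - int r + 2 * g.
            class_value n (a r) \<nu> * class_sum n \<nu> \<sigma>)))"
proof -
  \<comment> \<open>The main identity: the coefficients of the expansion are those of the series in the Jucys-Murphy
    elements. The value at a partition is taken at an arbitrary representative, which is conjugate to \<open>\<sigma>\<close>.\<close>
  have coeff: "class_value n (a r) (cycle_type n \<sigma>) = (-1) ^ r * h_coeff n r \<sigma>" if \<sigma>: "\<sigma> permutes {1..n}" for \<sigma>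
  proof -
    define \<sigma>0 where "\<sigma>0 = (SOME \<tau>. \<tau> permutes {1..n} \<and> cycle_type n \<tau> = cycle_type n \<sigma>)"
    have "\<sigma>0 permutes {1..n} \<and> cycle_type n \<sigma>0 = cycle_type n \<sigma>"
      using someI[of "\<lambda>\<tau>. \<tau> permutes {1..n} \<and> cycle_type n \<tau> = cycle_type n \<sigma>" \<sigma>] \<sigma>
      unfolding \<sigma>0_def by blast
    then have \<sigma>0: "\<sigma>0 permutes {1..n}" and ct: "cycle_type n \<sigma> = cycle_type n \<sigma>0" by auto
    obtain \<pi> where \<pi>: "\<pi> permutes {1..n}" "\<sigma>0 = \<pi> \<circ> \<sigma> \<circ> inv_into UNIV \<pi>"
      using conjugate_of_same_cycle_type[OF \<sigma> \<sigma>0 ct] by blast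
    have "(\<lambda>s. class_value n (a s) (cycle_type n \<sigma>)) = (\<lambda>s. (-1) ^ s * h_coeff n s \<sigma>)"
    proof (rule inverse_power_series_unique)
      \<comment> \<open>Large enough for the series to converge and for \<open>{1..n}\<close> to index rows.\<close>
      fix d assume d: "n + n ^ 2 + 1 \<le> d"
      then interpret unitary_haar d "H d" by unfold_locales (rule haar, simp)
      have sub: "{1..n} \<subseteq> {1..d}" using d by auto
      have "class_value n (weingarten n (H d)) (cycle_type n \<sigma>) = weingarten_on {1..n} \<sigma>0"
        unfolding class_value_def \<sigma>0_def[symmetric] by (rule weingarten_eq_weingarten_on[OF \<sigma>0])
      also have "\<dots> = weingarten_on {1..n} \<sigma>"
        using weingarten_on_conj[OF permutes_subset[OF \<pi>(1) sub] sub \<sigma>] permutes_image[OF \<pi>(1)]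
        by (simp only: \<pi>(2))
      finally show "(\<lambda>s. class_value n (a s) (cycle_type n \<sigma>) / of_nat d ^ (n + s)) sums weingarten_on {1..n} \<sigma>"
        using expansion[of d "cycle_type n \<sigma>"] d cycle_type_in_partitions[OF \<sigma>] by simp
      have nd: "n ^ 2 < d" using d by linarith
      show "(\<lambda>s. (-1) ^ s * h_coeff n s \<sigma> / of_nat d ^ (n + s)) sums weingarten_on {1..n} \<sigma>"
        using summable_sums[OF summable_jucys_series[OF nd, of \<sigma>]] weingarten_on_eq_jucys_series[OF nd \<sigma>]
        by (simp add: jucys_series_def[abs_def])
    qed
    then show ?thesis by (rule fun_cong)
  qed
  have sq: "(-1) ^ r * ((-1) ^ r * x) = x" for x :: complex
    by (simp add: power_mult_distrib[symmetric] mult.assoc[symmetric])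
  have sum: "(\<Sum>\<^sub>\<infinity>g \<in> {m..}. \<Sum>\<mu> | \<mu> \<in> partitions n \<and> int (size \<mu>) = int n - int r + 2 * g.
        class_value n (a r) \<mu> * class_sum n \<mu> \<sigma>)
      = (if \<sigma> permutes {1..n} \<and> (\<exists>g\<ge>m. int (size (cycle_type n \<sigma>)) = int n - int r + 2 * g)
          then (-1) ^ r * h_coeff n r \<sigma> else 0)" for m \<sigma>
    unfolding sum_class_sum infsum_single_index
    by (rule if_cong[OF refl _ refl]) (simp add: coeff)
  have level: "\<exists>g\<ge>0. int (size (cycle_type n \<sigma>)) = int n - int r + 2 * g" if "h_coeff n r \<sigma> \<noteq> 0" for \<sigma>
  proof -
    note len = h_coeff_nonzero_imp_length[OF that]
    obtain k where "n \<le> r + size (cycle_type n \<sigma>)" "n + r + size (cycle_type n \<sigma>) = 2 * k"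
      using len unfolding dvd_def by blast
    then show ?thesis by (intro exI[of _ "int k - int n"]) auto
  qed
  have "h_coeff n r \<sigma> = (-1) ^ r *
      (if \<sigma> permutes {1..n} \<and> (\<exists>g\<ge>0. int (size (cycle_type n \<sigma>)) = int n - int r + 2 * g)
        then (-1) ^ r * h_coeff n r \<sigma> else 0)" for \<sigma>
    using level h_coeff_permutes sq by (cases "h_coeff n r \<sigma> = 0") auto
  moreover have "h_coeff n r \<sigma> = (-1) ^ r *
      (if \<sigma> permutes {1..n} \<and> int (size (cycle_type n \<sigma>)) = int n - int r then Moeb (cycle_type n \<sigma>) else 0)
      + (-1) ^ r *
      (if \<sigma> permutes {1..n} \<and> (\<exists>g\<ge>1. int (size (cycle_type n \<sigma>)) = int n - int r + 2 * g)
        then (-1) ^ r * h_coeff n r \<sigma> else 0)" if r: "r < n" for \<sigma>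
  proof (cases "\<sigma> permutes {1..n} \<and> int (size (cycle_type n \<sigma>)) = int n - int r")
    case True
    then have len: "r + size (cycle_type n \<sigma>) = n" using r by linarith
    have "sum_mset (cycle_type n \<sigma>) = n" using cycle_type_in_partitions True by (auto simp: partitions_def)
    moreover have "n - size (cycle_type n \<sigma>) = r" using len by simp
    ultimately have "Moeb (cycle_type n \<sigma>) = (-1) ^ r * h_coeff n r \<sigma>"
      using h_coeff_leading[OF _ len] True by (simp add: Moeb_def)
    moreover have "\<not> (\<exists>g\<ge>1. int (size (cycle_type n \<sigma>)) = int n - int r + 2 * g)" using True by auto
    ultimately show ?thesis using True sq by simp
  next
    case False
    show ?thesis
    proof (cases "h_coeff n r \<sigma> = 0")
      case True
      show ?thesis unfolding if_not_P[OF False] True by simp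
    next
      case nz: False
      then have \<sigma>: "\<sigma> permutes {1..n}" by (rule h_coeff_permutes)
      from level[OF nz] obtain g where g: "g \<ge> 0" "int (size (cycle_type n \<sigma>)) = int n - int r + 2 * g" by auto
      then have "g \<noteq> 0" using False \<sigma> by auto
      then have "\<exists>g\<ge>1. int (size (cycle_type n \<sigma>)) = int n - int r + 2 * g" using g by (intro exI[of _ g]) auto
      then show ?thesis unfolding if_not_P[OF False] using \<sigma> sq by simp
    qed
  qed
  ultimately show ?thesis
    \<comment> \<open>The sums over \<open>g\<close> are evaluated before the remaining sum over one level.\<close>
    unfolding complete_homogeneous_jucys_murphy sum unfolding sum_class_sum by blast
qed

end
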